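(* Let $(Z_k)_{k\ge1}$ be i.i.d. standard normal random variables, let $\alpha_{\infty,1},\dots,\alpha_{\infty,q}$ be non-zero real numbers and for each $n\ge1$ let $(\alpha_{n,k})_{k\ge1}$ be a real sequence, with $\sum_{k=1}^q\alpha_{\infty,k}^2=1$ and $\sum_{k\ge1}\alpha_{n,k}^2=1$ for all $n$. Set $$F_n=\frac{1}{\sqrt2}\sum_{k\ge1}\alpha_{n,k}(Z_k^2-1),\qquad F_\infty=\frac1{\sqrt2}\sum_{k=1}^q\alpha_{\infty,k}(Z_k^2-1).$$ Then for any $\rho\in(0,1/(4e))$ there exists a strictly positive constant $C_{3,\rho}>0$ such that for all $n\ge1$, $$W_2(F_n,F_\infty)\ge C_{3,\rho}\,\Delta(F_n).$$
   Context: $W_2(F,G)=(\inf \mathbb{E}|X-Y|^2)^{1/2}$, the infimum being over all couplings $(X,Y)$ with $X\sim F$, $Y\sim G$ in law. Moreover $$\Delta(F_n)=\sum_{k\ge1}\alpha_{n,k}^2\prod_{r=1}^q(\alpha_{n,k}-\alpha_{\infty,r})^2 .$$ Constants do not depend on $n$. *)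

theory Defs
  imports "HOL-Probability.Probability"
begin

text \<open>Couplings of two laws on the real line, given by the joint law of the pair.\<close>

definition couplings :: "real measure \<Rightarrow> real measure \<Rightarrow> (real \<times> real) measure set" where
  "couplings \<mu> \<nu> =
     {\<pi>. prob_space \<pi> \<and> sets \<pi> = sets (borel \<Otimes>\<^sub>M borel) \<and>
          distr \<pi> borel fst = \<mu> \<and> distr \<pi> borel snd = \<nu>}"

definition ennsqrt :: "ennreal \<Rightarrow> ennreal" where
  "ennsqrt x = (if x = \<infinity> then \<infinity> else ennreal (sqrt (enn2real x)))"

definition wasserstein2 :: "real measure \<Rightarrow> real measure \<Rightarrow> ennreal" where
  "wasserstein2 \<mu> \<nu> =
     ennsqrt (INF \<pi>\<in>couplings \<mu> \<nu>. \<integral>\<^sup>+p. ennreal (\<bar>fst p - snd p\<bar>\<^sup>2) \<partial>\<pi>)"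

text \<open>
  All sequences are indexed from 0: the term of index \<open>k\<close> here is the one usually written
  with index \<open>k + 1\<close>.

  If the \<open>Z k\<close> are i.i.d. standard normal and \<open>a\<close> is square-summable, the series in
  \<open>chi_series\<close> need not converge absolutely, but its summands are independent and centred
  with summable variances \<open>2 * (a k)\<^sup>2\<close>, so it converges almost surely (and in mean
  square); the arbitrary value of the library sum where it diverges does not affect the law.
\<close>

definition chi_series :: "(nat \<Rightarrow> 'a \<Rightarrow> real) \<Rightarrow> (nat \<Rightarrow> real) \<Rightarrow> 'a \<Rightarrow> real" where
  "chi_series Z a = (\<lambda>\<omega>. 1 / sqrt 2 * (\<Sum>k. a k * ((Z k \<omega>)\<^sup>2 - 1)))"

definition chi_sum :: "(nat \<Rightarrow> 'a \<Rightarrow> real) \<Rightarrow> nat \<Rightarrow> (nat \<Rightarrow> real) \<Rightarrow> 'a \<Rightarrow> real" where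
  "chi_sum Z q a = (\<lambda>\<omega>. 1 / sqrt 2 * (\<Sum>k<q. a k * ((Z k \<omega>)\<^sup>2 - 1)))"

text \<open>\<open>Delta q b a\<close> has target coefficients \<open>b\<close>; it converges absolutely for square-summable
  \<open>a\<close>, since such an \<open>a\<close> is bounded.\<close>

definition Delta :: "nat \<Rightarrow> (nat \<Rightarrow> real) \<Rightarrow> (nat \<Rightarrow> real) \<Rightarrow> real" where
  "Delta q b a = (\<Sum>k. (a k)\<^sup>2 * (\<Prod>r<q. (a k - b r)\<^sup>2))"

end

theory Submission
  imports Defs
begin

text \<open>
  The quantity \<open>Delta\<close> is a fixed linear combination of cumulants, and
  cumulants of laws in the second Wiener chaos are Lipschitz with respect to \<open>W\<^sub>2\<close>.

  In detail: the moment generating function of \<open>\<Sum>k. a k * (Z\<^sub>k\<^sup>2 - 1) / sqrt 2\<close> is the product of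
  the factors \<open>(1 - sqrt 2 * a k * t) powr (-1/2) * exp (- a k * t / sqrt 2)\<close>, so its cumulant of
  order \<open>j \<ge> 2\<close> is a constant times the power sum \<open>\<Sum>k. a k ^ j\<close>. Expanding the polynomial
  \<open>P x = x\<^sup>2 * (\<Prod>r<q. (x - b r)\<^sup>2)\<close>, one sees that \<open>Delta q b a = (\<Sum>k. P (a k))\<close> is a linear
  combination of cumulants whose coefficients depend on \<open>b\<close> only. The same combination
  vanishes for the limit law, since every \<open>b r\<close> is a root of \<open>P\<close>. Hence \<open>Delta q b a\<close> is a linear
  combination of differences of cumulants of the two laws (\<open>Delta_eq_cumulants\<close>,
  \<open>Delta_target\<close>).

  For any coupling, \<open>E X ^ n - E Y ^ n\<close> is bounded by the \<open>L\<^sup>2\<close> distance of \<open>X\<close> and \<open>Y\<close> times a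
  constant that depends only on bounds for higher even moments (\<open>moment_diff_le\<close>). For
  coefficients with square sum at most 1 these bounds are uniform, because the cumulants are
  uniformly bounded and the moments follow from them by recursion
  (\<open>fps_exp_coeff_bound\<close>). Solved the other way round, the recursion makes the cumulants
  Lipschitz functions of the moments (\<open>log_deriv_lipschitz\<close>). Together this gives
  \<open>Delta q b a \<le> D * W\<^sub>2\<close> with \<open>D\<close> depending on \<open>q\<close> and \<open>b\<close> only.

  The relation between moments and cumulants is stated for formal power series, as
  \<open>F' = F * K\<close> with \<open>F\<close> the exponential generating function of the moments. For one summand it is
  a recursion obtained from Gaussian integration by parts; independence extends it to finite sums.
  The passage to the infinite series requires its almost sure convergence, which is Kolmogorov's
  theorem on series of independent centred variables (\<open>AE_summable_indep\<close>).
\<close>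

section \<open>Series of independent centred random variables\<close>

text \<open>
  The partial sums of \<open>x\<close>, frozen at the first one that reaches absolute value \<open>e\<close>. A value
  of at least \<open>e\<close> can only be a frozen one, so the recursion needs no memory of the past. This
  makes the maximum of the partial sums visible in the last term, and each step adds a summand
  whose coefficient depends on the earlier entries only.
\<close>

primrec stopped_sum :: "real \<Rightarrow> (nat \<Rightarrow> real) \<Rightarrow> nat \<Rightarrow> real" where
  "stopped_sum e x 0 = 0"
| "stopped_sum e x (Suc n) =
     (if e \<le> \<bar>stopped_sum e x n\<bar> then stopped_sum e x n else stopped_sum e x n + x n)"

lemma stopped_sum_restrict:
  "n \<le> m \<Longrightarrow> stopped_sum e (restrict x {..<m}) n = stopped_sum e x n"
  by (induction n) auto

lemma measurable_stopped_sum: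
  assumes "\<And>k. k < n \<Longrightarrow> (\<lambda>\<omega>. X \<omega> k) \<in> borel_measurable M"
  shows "(\<lambda>\<omega>. stopped_sum e (X \<omega>) n) \<in> borel_measurable M"
  using assms
proof (induction n)
  case (Suc n)
  have [measurable]: "(\<lambda>\<omega>. stopped_sum e (X \<omega>) n) \<in> borel_measurable M"
    using Suc by simp
  have [measurable]: "(\<lambda>\<omega>. X \<omega> n) \<in> borel_measurable M"
    using Suc by simp
  show ?case by simp
qed simp

lemma stopped_sum_below:
  "(\<And>k. k < n \<Longrightarrow> \<bar>\<Sum>i<k. x i\<bar> < e) \<Longrightarrow> stopped_sum e x n = (\<Sum>i<n. x i)"
proof (induction n)
  case (Suc n)
  then have "stopped_sum e x n = (\<Sum>i<n. x i)" by simp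
  with Suc.prems[of n] show ?case by simp
qed simp

lemma stopped_sum_stays:
  "e \<le> \<bar>stopped_sum e x m\<bar> \<Longrightarrow> m \<le> n \<Longrightarrow> stopped_sum e x n = stopped_sum e x m"
  by (induction n rule: nat_induct) (auto simp: le_Suc_eq)

lemma stopped_sum_exceeds:
  assumes "k \<le> n" "e \<le> \<bar>\<Sum>i<k. x i\<bar>"
  shows "e \<le> \<bar>stopped_sum e x n\<bar>"
proof -
  define m where "m = (LEAST k. e \<le> \<bar>\<Sum>i<k. x i\<bar>)"
  have m: "e \<le> \<bar>\<Sum>i<m. x i\<bar>" "m \<le> k"
    unfolding m_def using assms(2) by (rule LeastI, rule Least_le)
  have "stopped_sum e x m = (\<Sum>i<m. x i)"
    using not_less_Least[of _ "\<lambda>k. e \<le> \<bar>\<Sum>i<k. x i\<bar>"]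
    by (intro stopped_sum_below) (force simp: m_def[symmetric])
  with m assms(1) stopped_sum_stays[of e x m n] show ?thesis by simp
qed

context prob_space
begin

lemma indep_var_stopped_sum:
  assumes ind: "indep_vars (\<lambda>_. borel) X (UNIV :: nat set)"
  shows "indep_var borel (\<lambda>\<omega>. stopped_sum e (\<lambda>k. X k \<omega>) n) borel (X n)"
proof -
  have "indep_var
      borel ((\<lambda>f. stopped_sum e f n) \<circ> (\<lambda>\<omega>. restrict (\<lambda>i. X i \<omega>) {..<n}))
      borel ((\<lambda>f. f n) \<circ> (\<lambda>\<omega>. restrict (\<lambda>i. X i \<omega>) {n}))"
    by (intro indep_var_compose[OF indep_var_restrict[OF ind]] measurable_stopped_sum) auto
  then show ?thesis
    by (simp add: comp_def stopped_sum_restrict)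
qed

text \<open>
  A step of the stopped sum \<open>T\<close> adds \<open>c * X n\<close>, where \<open>c\<close> is 0 or 1 and is determined by \<open>T\<close>.
  As \<open>X n\<close> is centred and independent of \<open>T\<close>, the cross term vanishes in mean, so stopping can
  only lower the second moment below that of the full sum.
\<close>

lemma second_moment_stopped_sum:
  fixes X :: "nat \<Rightarrow> 'a \<Rightarrow> real"
  assumes ind: "indep_vars (\<lambda>_. borel) X UNIV"
    and sq: "\<And>k. integrable M (\<lambda>\<omega>. (X k \<omega>)\<^sup>2)"
    and centred: "\<And>k. expectation (X k) = 0"
  shows "integrable M (\<lambda>\<omega>. (stopped_sum e (\<lambda>k. X k \<omega>) n)\<^sup>2) \<and>
         expectation (\<lambda>\<omega>. (stopped_sum e (\<lambda>k. X k \<omega>) n)\<^sup>2) \<le> (\<Sum>k<n. expectation (\<lambda>\<omega>. (X k \<omega>)\<^sup>2))"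
proof (induction n)
  case (Suc n)
  have rv[measurable]: "X k \<in> borel_measurable M" for k
    using ind unfolding indep_vars_def by auto
  define T where "T = (\<lambda>\<omega>. stopped_sum e (\<lambda>k. X k \<omega>) n)"
  have [measurable]: "T \<in> borel_measurable M"
    unfolding T_def by (intro measurable_stopped_sum) simp
  \<comment> \<open>\<open>b T = T * c T\<close> is bounded by \<open>e\<close>, which makes the cross term integrable.\<close>
  define b where "b = (\<lambda>t::real. if e \<le> \<bar>t\<bar> then 0 else t)"
  define c where "c = (\<lambda>t::real. if e \<le> \<bar>t\<bar> then 0 else 1::real)"
  have [measurable]: "b \<in> borel_measurable borel" "c \<in> borel_measurable borel"
    unfolding b_def c_def by measurable
  have int_b: "integrable M (\<lambda>\<omega>. b (T \<omega>))"
    by (rule integrable_const_bound[where B="\<bar>e\<bar>"]) (auto simp: b_def)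
  have int_X: "integrable M (X n)"
    by (rule square_integrable_imp_integrable) (simp_all add: sq)
  have "indep_var borel (b \<circ> T) borel (id \<circ> X n)"
    by (rule indep_var_compose[OF indep_var_stopped_sum[OF ind, of e n, folded T_def]]) auto
  then have indb: "indep_var borel (\<lambda>\<omega>. b (T \<omega>)) borel (X n)" by (simp add: comp_def)
  have int_bX: "integrable M (\<lambda>\<omega>. b (T \<omega>) * X n \<omega>)"
    by (rule indep_var_integrable[OF indb int_b int_X])
  have zero: "expectation (\<lambda>\<omega>. b (T \<omega>) * X n \<omega>) = 0"
    using indep_var_lebesgue_integral[OF indb int_b int_X] centred[of n] by simp
  have int_cX: "integrable M (\<lambda>\<omega>. c (T \<omega>) * (X n \<omega>)\<^sup>2)"
    by (rule Bochner_Integration.integrable_bound[OF sq[of n]]) (auto simp: c_def)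
  have int_T: "integrable M (\<lambda>\<omega>. (T \<omega>)\<^sup>2)" using Suc by (simp add: T_def)
  have eq: "(stopped_sum e (\<lambda>k. X k \<omega>) (Suc n))\<^sup>2 =
      (T \<omega>)\<^sup>2 + 2 * (b (T \<omega>) * X n \<omega>) + c (T \<omega>) * (X n \<omega>)\<^sup>2" for \<omega>
    by (simp add: T_def b_def c_def power2_eq_square algebra_simps)
  have "expectation (\<lambda>\<omega>. c (T \<omega>) * (X n \<omega>)\<^sup>2) \<le> expectation (\<lambda>\<omega>. (X n \<omega>)\<^sup>2)"
    by (intro integral_mono int_cX sq) (auto simp: c_def)
  moreover have "expectation (\<lambda>\<omega>. (T \<omega>)\<^sup>2) \<le> (\<Sum>k<n. expectation (\<lambda>\<omega>. (X k \<omega>)\<^sup>2))"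
    using Suc by (simp add: T_def)
  ultimately show ?case
    unfolding eq using int_T int_bX int_cX zero by simp
qed simp

text \<open>
  Reaching \<open>e\<close> at some time up to \<open>n\<close> forces the stopped sum to be at least \<open>e\<close> in absolute
  value at time \<open>n\<close>; the claim is Chebyshev's inequality for the stopped sum.
\<close>

lemma Kolmogorov_maximal_inequality:
  fixes X :: "nat \<Rightarrow> 'a \<Rightarrow> real"
  assumes ind: "indep_vars (\<lambda>_. borel) X UNIV"
    and sq: "\<And>k. integrable M (\<lambda>\<omega>. (X k \<omega>)\<^sup>2)"
    and centred: "\<And>k. expectation (X k) = 0"
    and e: "e > 0"
  shows "prob {\<omega>\<in>space M. \<exists>k\<le>n. e \<le> \<bar>\<Sum>i<k. X i \<omega>\<bar>} \<le> (\<Sum>k<n. expectation (\<lambda>\<omega>. (X k \<omega>)\<^sup>2)) / e\<^sup>2"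
proof -
  have [measurable]: "X k \<in> borel_measurable M" for k
    using ind unfolding indep_vars_def by auto
  let ?T = "\<lambda>\<omega>. stopped_sum e (\<lambda>k. X k \<omega>) n"
  have [measurable]: "?T \<in> borel_measurable M"
    by (intro measurable_stopped_sum) simp
  note T = second_moment_stopped_sum[OF ind sq centred, of e n]
  have "prob {\<omega>\<in>space M. \<exists>k\<le>n. e \<le> \<bar>\<Sum>i<k. X i \<omega>\<bar>} \<le> prob {\<omega>\<in>space M. e \<le> \<bar>?T \<omega>\<bar>}"
    by (rule finite_measure_mono) (auto intro: stopped_sum_exceeds)
  also have "\<dots> \<le> expectation (\<lambda>\<omega>. (?T \<omega>)\<^sup>2) / e\<^sup>2"
    using T e by (intro second_moment_method) auto
  also have "\<dots> \<le> (\<Sum>k<n. expectation (\<lambda>\<omega>. (X k \<omega>)\<^sup>2)) / e\<^sup>2"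
    using T e by (intro divide_right_mono) auto
  finally show ?thesis .
qed

end

lemma Fatou_integral:
  fixes f :: "nat \<Rightarrow> 'a \<Rightarrow> real"
  assumes f: "\<And>n. integrable M (f n)" "\<And>n x. 0 \<le> f n x" "\<And>n. (\<integral>x. f n x \<partial>M) \<le> B"
    and lim: "AE x in M. (\<lambda>n. f n x) \<longlonglongrightarrow> g x"
    and g: "g \<in> borel_measurable M" "\<And>x. 0 \<le> g x"
  shows "integrable M g" "(\<integral>x. g x \<partial>M) \<le> B"
proof -
  have B: "0 \<le> B"
    using f(3)[of 0] Bochner_Integration.integral_nonneg[of M "f 0"] f(2) by (blast intro: order_trans)
  have "(\<integral>\<^sup>+x. ennreal (g x) \<partial>M) = (\<integral>\<^sup>+x. liminf (\<lambda>n. ennreal (f n x)) \<partial>M)"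
  proof (rule nn_integral_cong_AE, use lim in eventually_elim)
    fix x assume "(\<lambda>n. f n x) \<longlonglongrightarrow> g x"
    then show "ennreal (g x) = liminf (\<lambda>n. ennreal (f n x))"
      by (intro lim_imp_Liminf[symmetric] tendsto_ennrealI) auto
  qed
  also have "\<dots> \<le> liminf (\<lambda>n. \<integral>\<^sup>+x. ennreal (f n x) \<partial>M)"
    using f(1) by (intro nn_integral_liminf) auto
  also have "\<dots> = liminf (\<lambda>n. ennreal (\<integral>x. f n x \<partial>M))"
    using f by (simp add: nn_integral_eq_integral)
  also have "\<dots> \<le> liminf (\<lambda>n. ennreal B)"
    using f(3) by (intro Liminf_mono always_eventually allI ennreal_leI)
  also have "\<dots> = ennreal B" by (simp add: Liminf_const)
  finally have le: "(\<integral>\<^sup>+x. ennreal (g x) \<partial>M) \<le> ennreal B" .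
  show int: "integrable M g"
    using le g by (intro integrableI_nonneg) (auto simp: le_less_trans)
  show "(\<integral>x. g x \<partial>M) \<le> B"
    using le int g(2) B by (simp add: nn_integral_eq_integral)
qed

context prob_space
begin

lemma second_moment_indep_sum:
  fixes X :: "nat \<Rightarrow> 'a \<Rightarrow> real"
  assumes ind: "indep_vars (\<lambda>_. borel) X UNIV"
    and sq: "\<And>k. integrable M (\<lambda>\<omega>. (X k \<omega>)\<^sup>2)"
    and centred: "\<And>k. expectation (X k) = 0"
  shows "integrable M (\<lambda>\<omega>. (\<Sum>k<n. X k \<omega>)\<^sup>2) \<and>
         expectation (\<lambda>\<omega>. (\<Sum>k<n. X k \<omega>)\<^sup>2) = (\<Sum>k<n. expectation (\<lambda>\<omega>. (X k \<omega>)\<^sup>2))"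
proof (induction n)
  case (Suc n)
  have rv[measurable]: "X k \<in> borel_measurable M" for k
    using ind unfolding indep_vars_def by auto
  have int_X: "integrable M (X k)" for k
    by (rule square_integrable_imp_integrable) (simp_all add: sq)
  have indS: "indep_var borel (X n) borel (\<lambda>\<omega>. \<Sum>k<n. X k \<omega>)"
    by (rule indep_vars_sum) (auto intro: indep_vars_subset[OF ind])
  have int_S: "integrable M (\<lambda>\<omega>. \<Sum>k<n. X k \<omega>)" using int_X by simp
  note indep_var_integrable[OF indS int_X int_S]
  moreover have "expectation (\<lambda>\<omega>. X n \<omega> * (\<Sum>k<n. X k \<omega>)) = 0"
    using indep_var_lebesgue_integral[OF indS int_X int_S] centred by simp
  moreover have "(\<Sum>k<Suc n. X k \<omega>)\<^sup>2 = (\<Sum>k<n. X k \<omega>)\<^sup>2 + 2 * (X n \<omega> * (\<Sum>k<n. X k \<omega>)) + (X n \<omega>)\<^sup>2" for \<omega>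
    by (simp add: power2_eq_square algebra_simps)
  ultimately show ?case using Suc sq by simp
qed simp

text \<open>
  Continuity from below removes the time horizon, which is what convergence of the series
  requires.
\<close>

lemma Kolmogorov_maximal_inequality_infinite:
  fixes X :: "nat \<Rightarrow> 'a \<Rightarrow> real"
  assumes ind: "indep_vars (\<lambda>_. borel) X UNIV"
    and sq: "\<And>k. integrable M (\<lambda>\<omega>. (X k \<omega>)\<^sup>2)"
    and centred: "\<And>k. expectation (X k) = 0"
    and e: "e > 0"
    and v: "summable (\<lambda>k. expectation (\<lambda>\<omega>. (X k \<omega>)\<^sup>2))"
  shows "prob {\<omega>\<in>space M. \<exists>k. e \<le> \<bar>\<Sum>i<k. X i \<omega>\<bar>} \<le> (\<Sum>k. expectation (\<lambda>\<omega>. (X k \<omega>)\<^sup>2)) / e\<^sup>2"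
proof (rule LIMSEQ_le_const2)
  have [measurable]: "X k \<in> borel_measurable M" for k
    using ind unfolding indep_vars_def by auto
  let ?A = "\<lambda>n. {\<omega>\<in>space M. \<exists>k\<le>n. e \<le> \<bar>\<Sum>i<k. X i \<omega>\<bar>}"
  have "(\<lambda>n. prob (?A n)) \<longlonglongrightarrow> prob (\<Union>n. ?A n)"
    by (rule finite_Lim_measure_incseq) (auto simp: incseq_def intro: order.trans)
  moreover have "(\<Union>n. ?A n) = {\<omega>\<in>space M. \<exists>k. e \<le> \<bar>\<Sum>i<k. X i \<omega>\<bar>}" by auto
  ultimately show "(\<lambda>n. prob (?A n)) \<longlonglongrightarrow> prob {\<omega>\<in>space M. \<exists>k. e \<le> \<bar>\<Sum>i<k. X i \<omega>\<bar>}" by simp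
  have "prob (?A n) \<le> (\<Sum>k. expectation (\<lambda>\<omega>. (X k \<omega>)\<^sup>2)) / e\<^sup>2" for n
    using Kolmogorov_maximal_inequality[OF ind sq centred e, of n]
      divide_right_mono[OF sum_le_suminf[OF v, of "{..<n}"], of "e\<^sup>2"] by simp
  then show "\<exists>N. \<forall>n\<ge>N. prob (?A n) \<le> (\<Sum>k. expectation (\<lambda>\<omega>. (X k \<omega>)\<^sup>2)) / e\<^sup>2" by blast
qed

text \<open>
  Tails are obtained by replacing the first \<open>m\<close> variables by 0, which keeps the index set.
\<close>

lemma indep_vars_tail:
  fixes X :: "nat \<Rightarrow> 'a \<Rightarrow> real"
  assumes "indep_vars (\<lambda>_. borel) X UNIV"
  shows "indep_vars (\<lambda>_. borel) (\<lambda>k \<omega>. if k < m then 0 else X k \<omega>) UNIV"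
  using indep_vars_compose2[OF assms, of "\<lambda>k x. if k < m then 0 else x" "\<lambda>_. borel"] by simp

end

lemma sum_tail:
  fixes x :: "nat \<Rightarrow> real"
  shows "m \<le> n \<Longrightarrow> (\<Sum>k<n. if k < m then 0 else x k) = (\<Sum>k<n. x k) - (\<Sum>k<m. x k)"
  by (induction n rule: dec_induct) auto

lemma sums_tail:
  fixes x :: "nat \<Rightarrow> real"
  assumes "summable x"
  shows "(\<lambda>k. if k < m then 0 else x k) sums (suminf x - (\<Sum>k<m. x k))"
proof -
  have "(\<lambda>n. (\<Sum>k<n. x k) - (\<Sum>k<m. x k)) \<longlonglongrightarrow> suminf x - (\<Sum>k<m. x k)"
    using summable_LIMSEQ[OF assms] by (intro tendsto_intros)
  then show ?thesis
    unfolding sums_def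
    by (rule Lim_transform_eventually) (auto intro!: eventually_sequentiallyI[of m] simp: sum_tail)
qed

context prob_space
begin

text \<open>
  Kolmogorov's one-series theorem. The maximal inequality applied to the tails shows that the
  oscillation of the partial sums beyond \<open>m\<close> tends to 0 in probability; as it decreases in \<open>m\<close>,
  it tends to 0 almost surely, and the partial sums are almost surely Cauchy. The second moment
  of the remainder is then bounded by Fatou's lemma.
\<close>

lemma
  fixes X :: "nat \<Rightarrow> 'a \<Rightarrow> real"
  assumes ind: "indep_vars (\<lambda>_. borel) X UNIV"
    and sq: "\<And>k. integrable M (\<lambda>\<omega>. (X k \<omega>)\<^sup>2)"
    and centred: "\<And>k. expectation (X k) = 0"
    and v: "summable (\<lambda>k. expectation (\<lambda>\<omega>. (X k \<omega>)\<^sup>2))"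
  shows AE_summable_indep: "AE \<omega> in M. summable (\<lambda>k. X k \<omega>)"
    and second_moment_suminf_indep_tail:
      "integrable M (\<lambda>\<omega>. ((\<Sum>k. X k \<omega>) - (\<Sum>k<m. X k \<omega>))\<^sup>2)"
      "expectation (\<lambda>\<omega>. ((\<Sum>k. X k \<omega>) - (\<Sum>k<m. X k \<omega>))\<^sup>2)
         \<le> (\<Sum>k. expectation (\<lambda>\<omega>. (X k \<omega>)\<^sup>2)) - (\<Sum>k<m. expectation (\<lambda>\<omega>. (X k \<omega>)\<^sup>2))"
proof -
  have [measurable]: "X k \<in> borel_measurable M" for k
    using ind unfolding indep_vars_def by auto
  define v where "v = (\<lambda>k. expectation (\<lambda>\<omega>. (X k \<omega>)\<^sup>2))"
  have v: "summable v" using v by (simp add: v_def)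
  define Y where "Y = (\<lambda>m k \<omega>. if k < m then 0 else X k \<omega>)"
  have Ysq: "(Y m k \<omega>)\<^sup>2 = (if k < m then 0 else (X k \<omega>)\<^sup>2)" for m k \<omega> by (simp add: Y_def)
  have Y: "indep_vars (\<lambda>_. borel) (Y m) UNIV" "integrable M (\<lambda>\<omega>. (Y m k \<omega>)\<^sup>2)"
    "expectation (Y m k) = 0" "expectation (\<lambda>\<omega>. (Y m k \<omega>)\<^sup>2) = (if k < m then 0 else v k)" for m k
    unfolding Ysq v_def using indep_vars_tail[OF ind] sq centred by (cases "k < m"; simp add: Y_def)+
  have tail: "(\<lambda>k. if k < m then 0 else v k) sums (suminf v - (\<Sum>k<m. v k))" for m
    by (rule sums_tail[OF v])
  have small: "AE \<omega> in M. \<exists>m. \<forall>k. \<bar>\<Sum>i<k. Y m i \<omega>\<bar> < e" if e: "e > 0" for e :: real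
  proof -
    have [measurable]: "Y m k \<in> borel_measurable M" for m k unfolding Y_def by measurable
    \<comment> \<open>\<open>?N\<close> lies in the event of the maximal inequality for every tail, so it is a null set.\<close>
    let ?N = "{\<omega>\<in>space M. \<forall>m. \<exists>k. e \<le> \<bar>\<Sum>i<k. Y m i \<omega>\<bar>}"
    have "prob ?N \<le> (suminf v - (\<Sum>k<m. v k)) / e\<^sup>2" for m
    proof -
      have "prob ?N \<le> prob {\<omega>\<in>space M. \<exists>k. e \<le> \<bar>\<Sum>i<k. Y m i \<omega>\<bar>}"
        by (rule finite_measure_mono) auto
      also have "\<dots> \<le> (suminf v - (\<Sum>k<m. v k)) / e\<^sup>2"
        using Kolmogorov_maximal_inequality_infinite[OF Y(1-3) e, of m] tail[of m]
        by (simp add: Y(4) sums_iff)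
      finally show ?thesis .
    qed
    moreover have "(\<lambda>m. (suminf v - (\<Sum>k<m. v k)) / e\<^sup>2) \<longlonglongrightarrow> (suminf v - suminf v) / e\<^sup>2"
      using e by (intro tendsto_intros summable_LIMSEQ v) auto
    ultimately have "prob ?N \<le> 0"
      by (intro LIMSEQ_le_const) auto
    then have "prob ?N = 0" using measure_nonneg[of M ?N] by linarith
    then have "AE \<omega> in M. \<not> (\<forall>m. \<exists>k. e \<le> \<bar>\<Sum>i<k. Y m i \<omega>\<bar>)"
      by (subst (asm) prob_eq_0) (auto elim: AE_mp)
    then show ?thesis by eventually_elim (auto simp: not_le)
  qed
  have "AE \<omega> in M. \<forall>j. \<exists>m. \<forall>k. \<bar>\<Sum>i<k. Y m i \<omega>\<bar> < 1 / real (Suc j)"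
    by (subst AE_all_countable) (auto intro!: small)
  then show sm: "AE \<omega> in M. summable (\<lambda>k. X k \<omega>)"
  proof eventually_elim
    case (elim \<omega>)
    show "summable (\<lambda>k. X k \<omega>)"
      unfolding summable_Cauchy
    proof (intro allI impI)
      fix e :: real assume "e > 0"
      then obtain j where j: "1 / real (Suc j) < e / 2"
        using reals_Archimedean[of "e / 2"] by (auto simp: inverse_eq_divide)
      obtain m where m: "\<And>k. \<bar>\<Sum>i<k. Y m i \<omega>\<bar> < 1 / real (Suc j)" using elim by blast
      have "norm (\<Sum>i=p..<n. X i \<omega>) < e" if "m \<le> p" for p n
      proof (cases "p \<le> n")
        case True
        have "(\<Sum>i=p..<n. X i \<omega>) = (\<Sum>i<n. X i \<omega>) - (\<Sum>i<p. X i \<omega>)"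
          using sum_diff_nat_ivl[of 0 p n "\<lambda>i. X i \<omega>"] True by (simp add: atLeast0LessThan)
        also have "\<dots> = (\<Sum>i<n. Y m i \<omega>) - (\<Sum>i<p. Y m i \<omega>)"
          using True that by (simp add: Y_def sum_tail)
        finally show ?thesis using m[of n] m[of p] j by (simp only: real_norm_def)
      qed (use \<open>e > 0\<close> in simp)
      then show "\<exists>N. \<forall>m\<ge>N. \<forall>n. norm (\<Sum>i=m..<n. X i \<omega>) < e" by blast
    qed
  qed
  have lim: "AE \<omega> in M. (\<lambda>n. (\<Sum>k<n. Y m k \<omega>)\<^sup>2) \<longlonglongrightarrow> ((\<Sum>k. X k \<omega>) - (\<Sum>k<m. X k \<omega>))\<^sup>2"
    using sm
  proof eventually_elim
    case (elim \<omega>)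
    from sums_tail[OF elim, of m] show ?case
      unfolding sums_def Y_def by (intro tendsto_intros)
  qed
  have bound: "expectation (\<lambda>\<omega>. (\<Sum>k<n. Y m k \<omega>)\<^sup>2) \<le> suminf v - (\<Sum>k<m. v k)" for n
  proof -
    have "expectation (\<lambda>\<omega>. (\<Sum>k<n. Y m k \<omega>)\<^sup>2) = (\<Sum>k<n. if k < m then 0 else v k)"
      using second_moment_indep_sum[OF Y(1-3)] by (simp add: Y(4))
    also have "\<dots> \<le> suminf (\<lambda>k. if k < m then 0 else v k)"
      using tail[of m] by (intro sum_le_suminf) (auto simp: sums_iff v_def)
    finally show ?thesis using tail[of m] by (simp add: sums_iff)
  qed
  note * = Fatou_integral[OF _ _ bound lim]
  show "integrable M (\<lambda>\<omega>. ((\<Sum>k. X k \<omega>) - (\<Sum>k<m. X k \<omega>))\<^sup>2)"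
      "expectation (\<lambda>\<omega>. ((\<Sum>k. X k \<omega>) - (\<Sum>k<m. X k \<omega>))\<^sup>2)
         \<le> (\<Sum>k. expectation (\<lambda>\<omega>. (X k \<omega>)\<^sup>2)) - (\<Sum>k<m. expectation (\<lambda>\<omega>. (X k \<omega>)\<^sup>2))"
    unfolding v_def[symmetric]
    using second_moment_indep_sum[OF Y(1-3)] by (auto intro!: *)
qed

end

section \<open>Moments and mean square distance\<close>

text \<open>
  Factor \<open>x - y\<close> out of the difference and split the product by
  \<open>2 * u * v \<le> u\<^sup>2 / w + w * v\<^sup>2\<close>. The free parameter \<open>w\<close> plays the part of the \<open>L\<^sup>2\<close> distance,
  so that integrating yields a bound linear in \<open>w\<close>, as the Cauchy-Schwarz inequality would.
\<close>

lemma power_diff_le: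
  fixes x y w :: real
  assumes "w > 0"
  shows "\<bar>x ^ Suc m - y ^ Suc m\<bar> \<le> (x - y)\<^sup>2 / (2 * w) + w / 2 * (real (Suc m))\<^sup>2 * (x ^ (2 * m) + y ^ (2 * m))"
proof -
  define G where "G = (\<Sum>p<Suc m. x ^ p * y ^ (m - p))"
  define t where "t = max \<bar>x\<bar> \<bar>y\<bar>"
  have "\<bar>G\<bar> \<le> (\<Sum>p<Suc m. t ^ m)"
    unfolding G_def
  proof (rule order_trans[OF sum_abs], rule sum_mono)
    fix p assume "p \<in> {..<Suc m}"
    then have "t ^ m = t ^ p * t ^ (m - p)" by (simp flip: power_add)
    moreover have "\<bar>x\<bar> ^ p * \<bar>y\<bar> ^ (m - p) \<le> t ^ p * t ^ (m - p)"
      by (intro mult_mono power_mono) (auto simp: t_def)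
    ultimately show "\<bar>x ^ p * y ^ (m - p)\<bar> \<le> t ^ m" by (simp add: abs_mult power_abs)
  qed
  then have "\<bar>G\<bar> \<le> real (Suc m) * t ^ m" by simp
  then have "G\<^sup>2 \<le> (real (Suc m) * t ^ m)\<^sup>2" by (rule abs_le_square_iff[THEN iffD1, OF order_trans]) simp
  also have "\<dots> = (real (Suc m))\<^sup>2 * t ^ (2 * m)" by (simp add: power_mult_distrib power_mult mult.commute[of 2 m])
  also have "t ^ (2 * m) \<le> x ^ (2 * m) + y ^ (2 * m)"
    unfolding t_def max_def by (auto simp: power_even_abs)
  finally have G: "G\<^sup>2 \<le> (real (Suc m))\<^sup>2 * (x ^ (2 * m) + y ^ (2 * m))"
    by (simp add: mult_left_mono)
  have "\<bar>x ^ Suc m - y ^ Suc m\<bar> = \<bar>x - y\<bar> * \<bar>G\<bar>"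
    unfolding diff_power_eq_sum G_def by (simp only: abs_mult)
  also have "\<dots> \<le> (x - y)\<^sup>2 / (2 * w) + w / 2 * G\<^sup>2"
  proof -
    have "0 \<le> (\<bar>x - y\<bar> - w * \<bar>G\<bar>)\<^sup>2" by simp
    then have "2 * w * (\<bar>x - y\<bar> * \<bar>G\<bar>) \<le> (x - y)\<^sup>2 + w\<^sup>2 * G\<^sup>2"
      by (simp add: power2_diff power_mult_distrib algebra_simps)
    then show ?thesis using assms by (simp add: field_simps power2_eq_square)
  qed
  also have "w / 2 * G\<^sup>2 \<le> w / 2 * ((real (Suc m))\<^sup>2 * (x ^ (2 * m) + y ^ (2 * m)))"
    using assms G by (intro mult_left_mono) auto
  finally show ?thesis by (simp only: mult.assoc) 
qed

text \<open>
  Moments are Lipschitz with respect to the \<open>L\<^sup>2\<close> distance on sets where the even moments are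
  bounded. This serves twice: with \<open>X\<close> a partial sum and \<open>Y\<close> its limit, and with \<open>X\<close> and \<open>Y\<close> the
  coordinates of a coupling.
\<close>

lemma moment_diff_le:
  fixes X Y :: "'a \<Rightarrow> real"
  assumes X: "\<And>n. integrable M (\<lambda>\<omega>. X \<omega> ^ n)" and Y: "\<And>n. integrable M (\<lambda>\<omega>. Y \<omega> ^ n)"
    and BX: "(\<integral>\<omega>. X \<omega> ^ (2 * m) \<partial>M) \<le> B" and BY: "(\<integral>\<omega>. Y \<omega> ^ (2 * m) \<partial>M) \<le> B"
    and w: "w > 0" "(\<integral>\<omega>. (X \<omega> - Y \<omega>)\<^sup>2 \<partial>M) \<le> w\<^sup>2"
  shows "\<bar>(\<integral>\<omega>. X \<omega> ^ Suc m \<partial>M) - (\<integral>\<omega>. Y \<omega> ^ Suc m \<partial>M)\<bar> \<le> (1 / 2 + (real (Suc m))\<^sup>2 * B) * w"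
proof -
  note int = X[of "Suc m"] Y[of "Suc m"] X[of "2 * m"] Y[of "2 * m"]
  have meas: "X \<in> borel_measurable M" "Y \<in> borel_measurable M"
    using X[of 1] Y[of 1] by auto
  have sq: "integrable M (\<lambda>\<omega>. (X \<omega> - Y \<omega>)\<^sup>2)"
  proof (rule Bochner_Integration.integrable_bound)
    show "integrable M (\<lambda>\<omega>. 2 * (X \<omega>)\<^sup>2 + 2 * (Y \<omega>)\<^sup>2)" using X Y by simp
    have "(x - y)\<^sup>2 \<le> 2 * x\<^sup>2 + 2 * y\<^sup>2" for x y :: real
      using zero_le_power2[of "x + y"] by (simp add: power2_eq_square algebra_simps)
    then show "AE \<omega> in M. norm ((X \<omega> - Y \<omega>)\<^sup>2) \<le> norm (2 * (X \<omega>)\<^sup>2 + 2 * (Y \<omega>)\<^sup>2)" by simp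
  qed (use meas in measurable)
  have "\<bar>(\<integral>\<omega>. X \<omega> ^ Suc m \<partial>M) - (\<integral>\<omega>. Y \<omega> ^ Suc m \<partial>M)\<bar> = \<bar>\<integral>\<omega>. X \<omega> ^ Suc m - Y \<omega> ^ Suc m \<partial>M\<bar>"
    using int by (simp only: Bochner_Integration.integral_diff)
  also have "\<dots> \<le> (\<integral>\<omega>. \<bar>X \<omega> ^ Suc m - Y \<omega> ^ Suc m\<bar> \<partial>M)"
    by (rule integral_abs_bound)
  also have "\<dots> \<le> (\<integral>\<omega>. (X \<omega> - Y \<omega>)\<^sup>2 / (2 * w) + w / 2 * (real (Suc m))\<^sup>2 * (X \<omega> ^ (2 * m) + Y \<omega> ^ (2 * m)) \<partial>M)"
    using int sq w(1)
    by (intro integral_mono power_diff_le integrable_abs Bochner_Integration.integrable_diff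
        Bochner_Integration.integrable_add integrable_divide_zero integrable_mult_right) auto
  also have "\<dots> = (\<integral>\<omega>. (X \<omega> - Y \<omega>)\<^sup>2 \<partial>M) / (2 * w) +
      w / 2 * (real (Suc m))\<^sup>2 * ((\<integral>\<omega>. X \<omega> ^ (2 * m) \<partial>M) + (\<integral>\<omega>. Y \<omega> ^ (2 * m) \<partial>M))"
    using int(3,4) sq by simp
  also have "\<dots> \<le> w\<^sup>2 / (2 * w) + w / 2 * (real (Suc m))\<^sup>2 * (B + B)"
    using w BX BY by (intro add_mono divide_right_mono mult_left_mono) auto
  also have "\<dots> = (1 / 2 + (real (Suc m))\<^sup>2 * B) * w"
    using w(1) by (simp add: power2_eq_square field_simps)
  finally show ?thesis .
qed

lemma integrable_power_of_even:
  fixes X :: "'a \<Rightarrow> real"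
  assumes "finite_measure M" "X \<in> borel_measurable M" "integrable M (\<lambda>\<omega>. X \<omega> ^ (2 * n))"
  shows "integrable M (\<lambda>\<omega>. X \<omega> ^ n)"
proof (rule finite_measure.square_integrable_imp_integrable[OF assms(1)])
  show "integrable M (\<lambda>\<omega>. (X \<omega> ^ n)\<^sup>2)"
    using assms(3) by (simp add: power_mult[symmetric] mult.commute)
qed (use assms(2) in measurable)

section \<open>Gaussian moments\<close>

lemma integrable_std_normal_poly:
  "integrable lborel (\<lambda>x. std_normal_density x * poly p x)"
proof -
  have "integrable lborel (\<lambda>x. \<Sum>i\<le>degree p. coeff p i * (std_normal_density x * x ^ i))"
    by (intro Bochner_Integration.integrable_sum Bochner_Integration.integrable_mult_right
          integrable_std_normal_moment)
  also have "(\<lambda>x. \<Sum>i\<le>degree p. coeff p i * (std_normal_density x * x ^ i)) =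
      (\<lambda>x. std_normal_density x * poly p x)"
    by (simp add: poly_altdef sum_distrib_left mult_ac)
  finally show ?thesis .
qed

lemma integral_std_normal_poly:
  assumes "degree p \<le> N"
  shows "(\<integral>x. std_normal_density x * poly p x \<partial>lborel) =
         (\<Sum>i\<le>N. coeff p i * (\<integral>x. std_normal_density x * x ^ i \<partial>lborel))"
proof -
  have "std_normal_density x * poly p x = (\<Sum>i\<le>N. coeff p i * (std_normal_density x * x ^ i))" for x
  proof -
    have "poly p x = (\<Sum>i\<le>N. coeff p i * x ^ i)"
      unfolding poly_altdef using assms
      by (intro sum.mono_neutral_left) (auto simp: coeff_eq_0)
    then show ?thesis by (simp add: sum_distrib_left mult_ac)
  qed
  then show ?thesis
    by (simp add: integrable_std_normal_moment)
qed

lemma std_normal_moment_rec: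
  "(\<integral>x. std_normal_density x * x ^ Suc (Suc i) \<partial>lborel) =
     real (Suc i) * (\<integral>x. std_normal_density x * x ^ i \<partial>lborel)"
proof (cases "even i")
  case True
  then obtain k where i: "i = 2 * k" by blast
  have "(\<integral>x. std_normal_density x * x ^ (2 * Suc k) \<partial>lborel) =
      (2 * real k + 1) * (\<integral>x. std_normal_density x * x ^ (2 * k) \<partial>lborel)"
    unfolding integral_std_normal_moment_even by (simp add: divide_simps)
  then show ?thesis by (simp add: i)
next
  case False
  then obtain k where i: "i = 2 * k + 1" by (elim oddE)
  show ?thesis
    using integral_std_normal_moment_odd[of k] integral_std_normal_moment_odd[of "Suc k"]
    by (simp add: i)
qed

text \<open>
  Comparing coefficients, this is the recursion \<open>m (i + 2) = (i + 1) * m i\<close> of the standard normal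
  moments together with \<open>m 1 = 0\<close>.
\<close>

lemma std_normal_integration_by_parts:
  "(\<integral>x. std_normal_density x * (x * poly p x) \<partial>lborel) =
     (\<integral>x. std_normal_density x * poly (pderiv p) x \<partial>lborel)"
proof -
  define m where "m = (\<lambda>i::nat. \<integral>x. std_normal_density x * x ^ i \<partial>lborel)"
  define N where "N = degree p"
  have m1: "m (Suc 0) = 0" unfolding m_def using integral_std_normal_moment_odd[of 0] by simp
  have "(\<integral>x. std_normal_density x * (x * poly p x) \<partial>lborel) =
        (\<integral>x. std_normal_density x * poly (pCons 0 p) x \<partial>lborel)" by simp
  also have "\<dots> = (\<Sum>i\<le>Suc (Suc N). coeff (pCons 0 p) i * m i)"
    unfolding m_def by (rule integral_std_normal_poly) (auto simp: N_def)
  also have "\<dots> = (\<Sum>i\<le>N. coeff p (Suc i) * m (Suc (Suc i)))"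
    by (simp only: sum.atMost_Suc_shift) (simp add: m1)
  also have "\<dots> = (\<Sum>i\<le>N. coeff (pderiv p) i * m i)"
    unfolding m_def std_normal_moment_rec by (simp add: coeff_pderiv mult_ac)
  also have "\<dots> = (\<integral>x. std_normal_density x * poly (pderiv p) x \<partial>lborel)"
    unfolding m_def by (rule integral_std_normal_poly[symmetric]) (simp add: degree_pderiv N_def)
  finally show ?thesis .
qed

definition chi_moment :: "nat \<Rightarrow> real" where
  "chi_moment n = (\<integral>x. std_normal_density x * (x\<^sup>2 - 1) ^ n \<partial>lborel)"

lemma chi_moment_poly:
  "chi_moment n = (\<integral>x. std_normal_density x * poly ([:-1, 0, 1:] ^ n) x \<partial>lborel)"
  unfolding chi_moment_def by (simp add: power2_eq_square algebra_simps)

lemma chi_moment_0: "chi_moment 0 = 1"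
  unfolding chi_moment_def using integral_std_normal_moment_even[of 0] by simp

text \<open>
  Integration by parts for \<open>x * (x * (x\<^sup>2 - 1) ^ n)\<close>, where the derivative of
  \<open>x * (x\<^sup>2 - 1) ^ n\<close> is expressed through powers of \<open>x\<^sup>2 - 1\<close> by \<open>x\<^sup>2 = (x\<^sup>2 - 1) + 1\<close>.
  For \<open>n = 0\<close> the truncated index \<open>n - 1\<close> is harmless, because of the factor \<open>n\<close>.
\<close>

lemma chi_moment_Suc:
  "chi_moment (Suc n) = 2 * real n * (chi_moment n + chi_moment (n - 1))"
proof -
  let ?q = "[:-1, 0, 1:] :: real poly"
  let ?I = "\<lambda>p. \<integral>x. std_normal_density x * poly p x \<partial>lborel"
  have add: "?I (p + r) = ?I p + ?I r" for p r
    by (simp add: distrib_left integrable_std_normal_poly)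
  have scale: "?I (smult c p) = c * ?I p" for c p
    by (simp add: mult.left_commute)
  have Suc: "?q ^ Suc n = [:0, 1:] * ([:0, 1:] * ?q ^ n) + smult (-1) (?q ^ n)"
    by (simp add: algebra_simps)
  have "pderiv ([:0, 1:] * ?q ^ n) = ?q ^ n + smult (2 * real n) (?q ^ n + ?q ^ (n - 1))"
  proof (cases n)
    case (Suc k)
    have "pderiv ([:0, 1:] * ?q ^ n) = ?q ^ n + [:0, 1:] * (smult (real n) (?q ^ k) * [:0, 2:])"
      unfolding Suc pderiv_mult pderiv_power_Suc by (simp add: pderiv_pCons algebra_simps)
    also have "\<dots> = ?q ^ n + smult (2 * real n) (?q ^ n + ?q ^ k)"
      unfolding Suc by (simp add: algebra_simps)
    finally show ?thesis by (simp add: Suc)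
  qed (simp add: pderiv_pCons)
  then have "?I ([:0, 1:] * ([:0, 1:] * ?q ^ n)) = ?I (?q ^ n + smult (2 * real n) (?q ^ n + ?q ^ (n - 1)))"
    using std_normal_integration_by_parts[of "[:0, 1:] * ?q ^ n"] by simp
  then show ?thesis
    unfolding chi_moment_poly Suc add scale by (simp add: algebra_simps)
qed

section \<open>Moment generating series and their logarithmic derivatives\<close>

lemma fps_deriv_eq_mult_nth:
  assumes "fps_deriv F = F * K"
  shows "real (Suc n) * fps_nth F (Suc n) = (\<Sum>i\<le>n. fps_nth K i * fps_nth F (n - i))"
proof -
  have "real (Suc n) * fps_nth F (Suc n) = fps_nth (K * F) n"
    using arg_cong[OF assms, of "\<lambda>F. fps_nth F n"] by (simp add: mult.commute)
  then show ?thesis by (simp add: fps_mult_nth atLeast0AtMost)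
qed

text \<open>
  The coefficients of \<open>F\<close> solve a linear recursion with data \<open>K\<close>. The factor \<open>n + 1\<close> in front of
  the new coefficient absorbs the \<open>n + 1\<close> summands, each at most \<open>2 ^ n\<close>.
\<close>

lemma fps_exp_coeff_bound:
  fixes F K :: "real fps"
  assumes "fps_deriv F = F * K" "fps_nth F 0 = 1" "\<And>n. \<bar>fps_nth K n\<bar> \<le> 2 ^ n"
  shows "\<bar>fps_nth F n\<bar> \<le> 2 ^ n"
proof (induction n rule: less_induct)
  case (less n)
  show ?case
  proof (cases n)
    case (Suc m)
    have "real (Suc m) * \<bar>fps_nth F (Suc m)\<bar> = \<bar>\<Sum>i\<le>m. fps_nth K i * fps_nth F (m - i)\<bar>"
      using fps_deriv_eq_mult_nth[OF assms(1), of m] by (metis abs_mult abs_of_nat)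
    also have "\<dots> \<le> (\<Sum>i\<le>m. 2 ^ m)"
    proof (rule order_trans[OF sum_abs], rule sum_mono)
      fix i assume i: "i \<in> {..m}"
      have "\<bar>fps_nth K i * fps_nth F (m - i)\<bar> \<le> 2 ^ i * 2 ^ (m - i)"
        unfolding abs_mult using assms(3) less[of "m - i"] Suc by (intro mult_mono) auto
      then show "\<bar>fps_nth K i * fps_nth F (m - i)\<bar> \<le> 2 ^ m" using i by (simp flip: power_add)
    qed
    also have "\<dots> \<le> real (Suc m) * 2 ^ Suc m" by simp
    finally show ?thesis unfolding Suc by (subst (asm) mult_le_cancel_left_pos) auto
  qed (simp add: assms)
qed

text \<open>
  \<open>F\<close> is a moment generating series with logarithmic derivative \<open>K\<close>, and both obey the bounds that
  hold uniformly over all coefficient sequences with square sum at most 1.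
\<close>

definition tame_log_deriv :: "real fps \<Rightarrow> real fps \<Rightarrow> bool" where
  "tame_log_deriv F K \<longleftrightarrow> fps_deriv F = F * K \<and> fps_nth F 0 = 1 \<and>
     (\<forall>n. \<bar>fps_nth F n\<bar> \<le> 2 ^ n) \<and> (\<forall>n. \<bar>fps_nth K n\<bar> \<le> 2 ^ n)"

text \<open>
  The moment-cumulant recursion, solved for the cumulant of highest order.
\<close>

lemma tame_log_deriv_nth:
  assumes "tame_log_deriv F K"
  shows "fps_nth K n = real (Suc n) * fps_nth F (Suc n) - (\<Sum>i<n. fps_nth K i * fps_nth F (n - i))"
  using fps_deriv_eq_mult_nth[of F K n] assms
  by (simp add: tame_log_deriv_def lessThan_Suc_atMost[symmetric])

text \<open>
  Each cumulant is a polynomial in the moments of at most the same order, hence a Lipschitz function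
  of them on bounded sets. Following the recursion avoids writing that polynomial down: a difference
  of products is split as \<open>(k - l) * f + l * (f - g)\<close>. The point of the statement is the order of
  quantifiers: \<open>d\<close> depends on \<open>c\<close> and \<open>n\<close> only.
\<close>

lemma log_deriv_lipschitz:
  fixes c :: "nat \<Rightarrow> real"
  shows "\<exists>d. \<forall>F K G L w. tame_log_deriv F K \<longrightarrow> tame_log_deriv G L \<longrightarrow>
           (\<forall>i. \<bar>fps_nth F i - fps_nth G i\<bar> \<le> c i * w) \<longrightarrow> \<bar>fps_nth K n - fps_nth L n\<bar> \<le> d * w"
proof (induction n rule: less_induct)
  case (less n)
  then obtain d where d: "\<And>i F K G L w. \<lbrakk>i < n; tame_log_deriv F K; tame_log_deriv G L;
      \<And>i. \<bar>fps_nth F i - fps_nth G i\<bar> \<le> c i * w\<rbrakk> \<Longrightarrow> \<bar>fps_nth K i - fps_nth L i\<bar> \<le> d i * w"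
    by metis
  show ?case
  proof (intro exI allI impI)
    fix F K G L and w :: real
    assume FK: "tame_log_deriv F K" and GL: "tame_log_deriv G L"
      and c: "\<forall>i. \<bar>fps_nth F i - fps_nth G i\<bar> \<le> c i * w"
    let ?f = "fps_nth F" let ?g = "fps_nth G" let ?k = "fps_nth K" let ?l = "fps_nth L"
    have step: "\<bar>?k i * ?f (n - i) - ?l i * ?g (n - i)\<bar> \<le> (d i * 2 ^ (n - i) + 2 ^ i * c (n - i)) * w"
      if "i < n" for i
    proof -
      have "?k i * ?f (n - i) - ?l i * ?g (n - i) = (?k i - ?l i) * ?f (n - i) + ?l i * (?f (n - i) - ?g (n - i))"
        by (simp add: algebra_simps)
      also have "\<bar>\<dots>\<bar> \<le> \<bar>?k i - ?l i\<bar> * \<bar>?f (n - i)\<bar> + \<bar>?l i\<bar> * \<bar>?f (n - i) - ?g (n - i)\<bar>"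
        by (rule order_trans[OF abs_triangle_ineq]) (simp add: abs_mult)
      also have "\<dots> \<le> (d i * w) * 2 ^ (n - i) + 2 ^ i * (c (n - i) * w)"
        using FK GL d[OF that FK GL, of w] c order_trans[OF abs_ge_zero]
        by (intro add_mono mult_mono) (auto simp: tame_log_deriv_def)
      finally show ?thesis by (simp add: algebra_simps)
    qed
    have "?k n - ?l n = real (Suc n) * (?f (Suc n) - ?g (Suc n)) - (\<Sum>i<n. ?k i * ?f (n - i) - ?l i * ?g (n - i))"
      unfolding tame_log_deriv_nth[OF FK, of n] tame_log_deriv_nth[OF GL, of n]
      by (simp add: sum_subtractf algebra_simps)
    also have "\<bar>\<dots>\<bar> \<le> real (Suc n) * \<bar>?f (Suc n) - ?g (Suc n)\<bar> + (\<Sum>i<n. \<bar>?k i * ?f (n - i) - ?l i * ?g (n - i)\<bar>)"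
      by (rule order_trans[OF abs_triangle_ineq4]) (intro add_mono sum_abs, simp add: abs_mult)
    also have "\<dots> \<le> real (Suc n) * (c (Suc n) * w) + (\<Sum>i<n. (d i * 2 ^ (n - i) + 2 ^ i * c (n - i)) * w)"
      using c by (intro add_mono mult_left_mono sum_mono step) auto
    also have "\<dots> = (real (Suc n) * c (Suc n) + (\<Sum>i<n. d i * 2 ^ (n - i) + 2 ^ i * c (n - i))) * w"
      by (simp add: sum_distrib_right distrib_right)
    finally show "\<bar>?k n - ?l n\<bar> \<le> (real (Suc n) * c (Suc n) + (\<Sum>i<n. d i * 2 ^ (n - i) + 2 ^ i * c (n - i))) * w" .
  qed
qed

text \<open>
  The exponential generating function of the moments as a formal power series: independence turns
  sums into products, with no question of convergence.
\<close>

definition moment_fps :: "'a measure \<Rightarrow> ('a \<Rightarrow> real) \<Rightarrow> real fps" where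
  "moment_fps M X = Abs_fps (\<lambda>n. (\<integral>\<omega>. X \<omega> ^ n \<partial>M) / fact n)"

text \<open>
  The logarithmic derivative of \<open>E exp (t * a * (Z\<^sup>2 - 1) / sqrt 2)\<close>, that is, of
  \<open>(1 - sqrt 2 * a * t) powr (-1/2) * exp (- a * t / sqrt 2)\<close>, expanded at \<open>t = 0\<close>. Its
  coefficient of index \<open>i\<close> is the cumulant of order \<open>i + 1\<close> divided by \<open>i!\<close>.
\<close>

definition cumulant_fps :: "real \<Rightarrow> real fps" where
  "cumulant_fps a = Abs_fps (\<lambda>i. if i = 0 then 0 else sqrt 2 ^ i / sqrt 2 * a ^ Suc i)"

text \<open>
  The closed form \<open>a\<^sup>2 * X / (1 - sqrt 2 * a * X)\<close> of the geometric series, without the division.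
\<close>

lemma cumulant_fps_mult:
  "cumulant_fps a * (1 - fps_const (sqrt 2 * a) * fps_X) = fps_const (a\<^sup>2) * fps_X"
proof (rule fps_ext)
  fix n
  have "cumulant_fps a * (1 - fps_const (sqrt 2 * a) * fps_X) =
      cumulant_fps a - fps_const (sqrt 2 * a) * (cumulant_fps a * fps_X)"
    by (simp add: algebra_simps)
  then show "fps_nth (cumulant_fps a * (1 - fps_const (sqrt 2 * a) * fps_X)) n = fps_nth (fps_const (a\<^sup>2) * fps_X) n"
    by (cases n) (auto simp: cumulant_fps_def power2_eq_square field_simps)
qed

context prob_space
begin

text \<open>
  For the third claim, multiply by \<open>1 - sqrt 2 * a * X\<close>: the differential equation becomes the
  two-step recursion of \<open>chi_moment\<close>, and the factor cancels because power series over a field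
  form an integral domain.
\<close>

lemma moment_fps_chi:
  assumes D: "distributed M lborel X std_normal_density"
  shows "integrable M (\<lambda>\<omega>. (a / sqrt 2 * ((X \<omega>)\<^sup>2 - 1)) ^ n)"
    and "expectation (\<lambda>\<omega>. (a / sqrt 2 * ((X \<omega>)\<^sup>2 - 1)) ^ n) = (a / sqrt 2) ^ n * chi_moment n"
    and "fps_deriv (moment_fps M (\<lambda>\<omega>. a / sqrt 2 * ((X \<omega>)\<^sup>2 - 1))) =
         moment_fps M (\<lambda>\<omega>. a / sqrt 2 * ((X \<omega>)\<^sup>2 - 1)) * cumulant_fps a"
proof -
  have "integrable lborel (\<lambda>x. std_normal_density x * (x\<^sup>2 - 1) ^ n)"
    using integrable_std_normal_poly[of "[:-1, 0, 1:] ^ n"]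
    by (simp add: power2_eq_square algebra_simps)
  then have "integrable M (\<lambda>\<omega>. ((X \<omega>)\<^sup>2 - 1) ^ n)"
    by (subst (asm) distributed_integrable[OF D]) auto
  then show "integrable M (\<lambda>\<omega>. (a / sqrt 2 * ((X \<omega>)\<^sup>2 - 1)) ^ n)"
    unfolding power_mult_distrib by (rule Bochner_Integration.integrable_mult_right)
  have E: "expectation (\<lambda>\<omega>. (a / sqrt 2 * ((X \<omega>)\<^sup>2 - 1)) ^ n) = (a / sqrt 2) ^ n * chi_moment n" for n
  proof -
    have "expectation (\<lambda>\<omega>. ((X \<omega>)\<^sup>2 - 1) ^ n) = chi_moment n"
      unfolding chi_moment_def by (rule distributed_integral[OF D, symmetric]) auto
    then show ?thesis
      by (simp only: power_mult_distrib integral_mult_right_zero)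
  qed
  then show "expectation (\<lambda>\<omega>. (a / sqrt 2 * ((X \<omega>)\<^sup>2 - 1)) ^ n) = (a / sqrt 2) ^ n * chi_moment n" .
  define F where "F = moment_fps M (\<lambda>\<omega>. a / sqrt 2 * ((X \<omega>)\<^sup>2 - 1))"
  have F: "fps_nth F n = (a / sqrt 2) ^ n * chi_moment n / fact n" for n
    by (simp only: F_def moment_fps_def fps_nth_Abs_fps E)
  have "fps_deriv F * (1 - fps_const (sqrt 2 * a) * fps_X) =
      fps_deriv F - fps_const (sqrt 2 * a) * (fps_deriv F * fps_X)"
    by (simp add: algebra_simps)
  also have "\<dots> = fps_const (a\<^sup>2) * (F * fps_X)"
  proof (rule fps_ext)
    fix n
    have s: "sqrt 2 * sqrt 2 = 2" by simp
    show "fps_nth (fps_deriv F - fps_const (sqrt 2 * a) * (fps_deriv F * fps_X)) n = fps_nth (fps_const (a\<^sup>2) * (F * fps_X)) n"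
    proof (cases n)
      case 0
      then show ?thesis by (simp add: F chi_moment_Suc)
    next
      case (Suc k)
      have "real (Suc k) \<noteq> 0" by simp
      then show ?thesis using s
        by (simp add: Suc F chi_moment_Suc[of "Suc k"] divide_simps power2_eq_square)
           (simp add: algebra_simps)
    qed
  qed
  also have "\<dots> = (F * cumulant_fps a) * (1 - fps_const (sqrt 2 * a) * fps_X)"
    by (simp only: mult.assoc cumulant_fps_mult) (simp add: mult_ac)
  finally have "fps_deriv F * (1 - fps_const (sqrt 2 * a) * fps_X) =
      (F * cumulant_fps a) * (1 - fps_const (sqrt 2 * a) * fps_X)" .
  moreover have "1 - fps_const (sqrt 2 * a) * fps_X \<noteq> 0"
  proof
    assume "1 - fps_const (sqrt 2 * a) * fps_X = 0"
    then have "fps_nth (1 - fps_const (sqrt 2 * a) * fps_X) 0 = fps_nth (0 :: real fps) 0" by simp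
    then show False by simp
  qed
  ultimately show "fps_deriv F = F * cumulant_fps a" by simp
qed

lemma moment_fps_add:
  assumes ind: "indep_var borel X borel Y"
    and X: "\<And>n. integrable M (\<lambda>\<omega>. X \<omega> ^ n)" and Y: "\<And>n. integrable M (\<lambda>\<omega>. Y \<omega> ^ n)"
  shows "integrable M (\<lambda>\<omega>. (X \<omega> + Y \<omega>) ^ n)"
    and "moment_fps M (\<lambda>\<omega>. X \<omega> + Y \<omega>) = moment_fps M X * moment_fps M Y"
proof -
  have pow: "indep_var borel (\<lambda>\<omega>. X \<omega> ^ i) borel (\<lambda>\<omega>. Y \<omega> ^ j)" for i j :: nat
    using indep_var_compose[OF ind, of "\<lambda>x. x ^ i" borel "\<lambda>x. x ^ j" borel] by (simp add: comp_def)
  note int = indep_var_integrable[OF pow X Y]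
  note E = indep_var_lebesgue_integral[OF pow X Y]
  have eq: "(X \<omega> + Y \<omega>) ^ n = (\<Sum>i\<le>n. real (n choose i) * (X \<omega> ^ i * Y \<omega> ^ (n - i)))" for \<omega> n
    by (simp add: binomial_ring mult.assoc)
  show "integrable M (\<lambda>\<omega>. (X \<omega> + Y \<omega>) ^ n)"
    unfolding eq using int by simp
  show "moment_fps M (\<lambda>\<omega>. X \<omega> + Y \<omega>) = moment_fps M X * moment_fps M Y"
  proof (rule fps_ext)
    fix n
    have "expectation (\<lambda>\<omega>. (X \<omega> + Y \<omega>) ^ n) / fact n =
        (\<Sum>i\<le>n. real (n choose i) * (expectation (\<lambda>\<omega>. X \<omega> ^ i) * expectation (\<lambda>\<omega>. Y \<omega> ^ (n - i)))) / fact n"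
      unfolding eq using int by (simp add: E)
    also have "\<dots> = (\<Sum>i\<le>n. expectation (\<lambda>\<omega>. X \<omega> ^ i) / fact i * (expectation (\<lambda>\<omega>. Y \<omega> ^ (n - i)) / fact (n - i)))"
      unfolding sum_divide_distrib by (intro sum.cong refl) (simp add: binomial_fact)
    finally show "fps_nth (moment_fps M (\<lambda>\<omega>. X \<omega> + Y \<omega>)) n = fps_nth (moment_fps M X * moment_fps M Y) n"
      by (simp add: moment_fps_def fps_mult_nth atLeast0AtMost)
  qed
qed

end

section \<open>Power sums of the coefficients\<close>

lemma abs_coeff_le_1:
  fixes a :: "nat \<Rightarrow> real"
  assumes "summable (\<lambda>k. (a k)\<^sup>2)" "(\<Sum>k. (a k)\<^sup>2) \<le> 1"
  shows "\<bar>a k\<bar> \<le> 1"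
proof -
  have "(a k)\<^sup>2 \<le> (\<Sum>k. (a k)\<^sup>2)"
    using sum_le_suminf[OF assms(1), of "{k}"] by simp
  then show ?thesis using assms(2) by (simp flip: abs_square_le_1)
qed

lemma abs_power_le_square:
  fixes x :: real
  assumes "\<bar>x\<bar> \<le> 1"
  shows "\<bar>x ^ (j + 2)\<bar> \<le> x\<^sup>2"
proof -
  have "\<bar>x\<bar> ^ j * x\<^sup>2 \<le> 1 * x\<^sup>2"
    using assms by (intro mult_right_mono power_le_one) auto
  then show ?thesis by (simp only: power_add abs_mult power_abs power2_abs mult_1)
qed

lemma summable_power_coeff:
  fixes a :: "nat \<Rightarrow> real"
  assumes "summable (\<lambda>k. (a k)\<^sup>2)" "(\<Sum>k. (a k)\<^sup>2) \<le> 1"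
  shows "summable (\<lambda>k. a k ^ (j + 2))"
  by (rule summable_comparison_test'[OF assms(1), of 0])
     (use abs_power_le_square[OF abs_coeff_le_1[OF assms]] in simp)

text \<open>
  Cumulants add up over independent summands, so for a whole sequence the powers of \<open>a\<close> in
  \<open>cumulant_fps\<close> turn into power sums. These determine \<open>Delta\<close>.
\<close>

definition chi_cumulants :: "(nat \<Rightarrow> real) \<Rightarrow> real fps" where
  "chi_cumulants a = Abs_fps (\<lambda>i. if i = 0 then 0 else sqrt 2 ^ i / sqrt 2 * (\<Sum>k. a k ^ Suc i))"

lemma cumulant_nth_bound:
  assumes "\<bar>p\<bar> \<le> 1"
  shows "\<bar>sqrt 2 ^ i / sqrt 2 * p\<bar> \<le> 2 ^ i"
proof -
  have "\<bar>sqrt 2 ^ i / sqrt 2 * p\<bar> = sqrt 2 ^ i / sqrt 2 * \<bar>p\<bar>" by (simp add: abs_mult)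
  also have "\<dots> \<le> sqrt 2 ^ i / 1 * 1"
    using assms by (intro mult_mono divide_left_mono) auto
  also have "\<dots> \<le> 2 ^ i" by (simp add: power_mono real_le_lsqrt)
  finally show ?thesis .
qed

lemma chi_cumulants_bound:
  assumes a: "summable (\<lambda>k. (a k)\<^sup>2)" "(\<Sum>k. (a k)\<^sup>2) \<le> 1"
  shows "\<bar>fps_nth (chi_cumulants a) i\<bar> \<le> 2 ^ i"
proof (cases i)
  case (Suc j)
  have le: "\<bar>a k ^ (j + 2)\<bar> \<le> (a k)\<^sup>2" for k
    by (rule abs_power_le_square[OF abs_coeff_le_1[OF a]])
  have sm: "summable (\<lambda>k. \<bar>a k ^ (j + 2)\<bar>)"
    by (rule summable_comparison_test'[OF a(1), of 0]) (use le in simp)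
  have "\<bar>\<Sum>k. a k ^ (j + 2)\<bar> \<le> (\<Sum>k. \<bar>a k ^ (j + 2)\<bar>)"
    by (rule summable_rabs[OF sm])
  also have "\<dots> \<le> (\<Sum>k. (a k)\<^sup>2)"
    by (rule suminf_le[OF le sm a(1)])
  finally have "\<bar>\<Sum>k. a k ^ (j + 2)\<bar> \<le> 1" using a(2) by simp
  from cumulant_nth_bound[OF this, of i] show ?thesis by (simp add: chi_cumulants_def Suc)
qed (simp add: chi_cumulants_def)

lemma chi_cumulants_truncate:
  "(\<Sum>k<N. cumulant_fps (a k)) = chi_cumulants (\<lambda>k. if k < N then a k else 0)"
proof (rule fps_ext)
  fix i
  have "(\<Sum>k. (if k < N then a k else 0) ^ Suc i) = (\<Sum>k<N. a k ^ Suc i)"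
    by (subst suminf_finite[of "{..<N}"]) auto
  then show "fps_nth (\<Sum>k<N. cumulant_fps (a k)) i = fps_nth (chi_cumulants (\<lambda>k. if k < N then a k else 0)) i"
    by (simp add: chi_cumulants_def fps_sum_nth cumulant_fps_def sum_distrib_left)
qed

text \<open>
  A summand of \<open>Delta q b a\<close> is \<open>x\<^sup>2\<close> times the value of this polynomial at \<open>x = a k\<close>.
\<close>

definition Delta_poly :: "nat \<Rightarrow> (nat \<Rightarrow> real) \<Rightarrow> real poly" where
  "Delta_poly q b = (\<Prod>r<q. [:- b r, 1:]\<^sup>2)"

text \<open>
  Expanding the polynomial and exchanging the sums writes \<open>Delta\<close> as a combination of the power
  sums of orders 2 and higher, which are the cumulants up to powers of \<open>sqrt 2\<close>. The coefficients
  do not involve \<open>a\<close>.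
\<close>

lemma Delta_eq_cumulants:
  assumes a: "summable (\<lambda>k. (a k)\<^sup>2)" "(\<Sum>k. (a k)\<^sup>2) \<le> 1"
  shows "Delta q b a =
    (\<Sum>j\<le>degree (Delta_poly q b). coeff (Delta_poly q b) j / sqrt 2 ^ j * fps_nth (chi_cumulants a) (Suc j))"
proof -
  have "(a k)\<^sup>2 * (\<Prod>r<q. (a k - b r)\<^sup>2) = (\<Sum>j\<le>degree (Delta_poly q b). coeff (Delta_poly q b) j * a k ^ (j + 2))" for k
  proof -
    have "(\<Prod>r<q. (a k - b r)\<^sup>2) = poly (Delta_poly q b) (a k)"
      by (simp add: Delta_poly_def poly_prod)
    then show ?thesis
      by (simp add: poly_altdef sum_distrib_left power_add power2_eq_square mult_ac)
  qed
  then have "Delta q b a = (\<Sum>k. \<Sum>j\<le>degree (Delta_poly q b). coeff (Delta_poly q b) j * a k ^ (j + 2))"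
    by (simp add: Delta_def)
  also have "\<dots> = (\<Sum>j\<le>degree (Delta_poly q b). coeff (Delta_poly q b) j * (\<Sum>k. a k ^ (j + 2)))"
    using summable_power_coeff[OF a] by (subst suminf_sum) (auto simp: suminf_mult)
  also have "\<dots> = (\<Sum>j\<le>degree (Delta_poly q b). coeff (Delta_poly q b) j / sqrt 2 ^ j * fps_nth (chi_cumulants a) (Suc j))"
    by (simp add: chi_cumulants_def)
  finally show ?thesis .
qed

text \<open>
  The limit coefficients, padded with zeros, are exactly roots of \<open>x\<^sup>2 * (\<Prod>r<q. (x - b r)\<^sup>2)\<close>. Therefore
  \<open>Delta\<close> itself is a difference of two values of the same combination of cumulants.
\<close>

lemma Delta_target: "Delta q b (\<lambda>k. if k < q then b k else 0) = 0"
proof -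
  have "(if k < q then b k else 0)\<^sup>2 * (\<Prod>r<q. ((if k < q then b k else 0) - b r)\<^sup>2) = 0" for k
    by (auto simp: prod_zero_iff)
  then show ?thesis by (simp only: Delta_def suminf_zero)
qed

section \<open>Series in the second Wiener chaos\<close>

text \<open>
  A probability space carrying an i.i.d. standard normal sequence, on which every
  square-summable coefficient sequence is realised at the same time.
\<close>

locale std_normal_sequence = prob_space +
  fixes Z :: "nat \<Rightarrow> 'a \<Rightarrow> real"
  assumes indep: "indep_vars (\<lambda>_. borel) Z UNIV"
    and std_normal: "\<And>k. distributed M lborel (Z k) std_normal_density"
begin

definition chi_term :: "(nat \<Rightarrow> real) \<Rightarrow> nat \<Rightarrow> 'a \<Rightarrow> real" where
  "chi_term a k \<omega> = a k / sqrt 2 * ((Z k \<omega>)\<^sup>2 - 1)"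

definition chi_part :: "(nat \<Rightarrow> real) \<Rightarrow> nat \<Rightarrow> 'a \<Rightarrow> real" where
  "chi_part a N \<omega> = (\<Sum>k<N. chi_term a k \<omega>)"

definition chi_lim :: "(nat \<Rightarrow> real) \<Rightarrow> 'a \<Rightarrow> real" where
  "chi_lim a \<omega> = (\<Sum>k. chi_term a k \<omega>)"

lemma measurable_Z[measurable]: "Z k \<in> borel_measurable M"
  using std_normal[of k] by (auto simp: distributed_def)

lemma measurable_chi[measurable]:
  "chi_term a k \<in> borel_measurable M" "chi_part a N \<in> borel_measurable M" "chi_lim a \<in> borel_measurable M"
  unfolding chi_term_def chi_part_def chi_lim_def by measurable

lemma indep_chi_term: "indep_vars (\<lambda>_. borel) (chi_term a) UNIV"
proof -
  have "indep_vars (\<lambda>_. borel) (\<lambda>k \<omega>. (\<lambda>x. a k / sqrt 2 * (x\<^sup>2 - 1)) (Z k \<omega>)) UNIV"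
    by (rule indep_vars_compose2[OF indep]) simp
  then show ?thesis by (simp add: chi_term_def[abs_def])
qed

lemma integrable_chi_term_power: "integrable M (\<lambda>\<omega>. chi_term a k \<omega> ^ n)"
  unfolding chi_term_def by (rule moment_fps_chi(1)[OF std_normal])

lemma expectation_chi_term: "expectation (chi_term a k) = 0"
  using moment_fps_chi(2)[OF std_normal, of "a k" k 1] chi_moment_Suc[of 0]
  by (simp add: chi_term_def[abs_def])

lemma second_moment_chi_term: "expectation (\<lambda>\<omega>. (chi_term a k \<omega>)\<^sup>2) = (a k)\<^sup>2"
  using moment_fps_chi(2)[OF std_normal, of "a k" k 2] chi_moment_Suc[of 0] chi_moment_Suc[of 1] chi_moment_0
  by (simp add: chi_term_def[abs_def] power_divide numeral_2_eq_2)

lemma moment_fps_chi_part: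
  shows "integrable M (\<lambda>\<omega>. chi_part a N \<omega> ^ n)"
    and "fps_deriv (moment_fps M (chi_part a N)) = moment_fps M (chi_part a N) * (\<Sum>k<N. cumulant_fps (a k))"
proof -
  have "(\<forall>n. integrable M (\<lambda>\<omega>. chi_part a N \<omega> ^ n)) \<and>
    fps_deriv (moment_fps M (chi_part a N)) = moment_fps M (chi_part a N) * (\<Sum>k<N. cumulant_fps (a k))"
  proof (induction N)
    case 0
    have "moment_fps M (chi_part a 0) = 1"
      by (rule fps_ext) (simp add: moment_fps_def chi_part_def prob_space power_0_left)
    moreover have "integrable M (\<lambda>\<omega>. chi_part a 0 \<omega> ^ n)" for n
      by (simp add: chi_part_def)
    ultimately show ?case by simp
  next
    case (Suc N)
    have ind: "indep_var borel (chi_term a N) borel (chi_part a N)"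
      unfolding chi_part_def[abs_def]
      by (rule indep_vars_sum) (auto intro: indep_vars_subset[OF indep_chi_term])
    have eq: "chi_part a (Suc N) = (\<lambda>\<omega>. chi_term a N \<omega> + chi_part a N \<omega>)"
      by (auto simp: chi_part_def)
    note add = moment_fps_add[OF ind integrable_chi_term_power conjunct1[OF Suc, rule_format]]
    have d: "fps_deriv (moment_fps M (chi_term a N)) = moment_fps M (chi_term a N) * cumulant_fps (a N)"
      unfolding chi_term_def[abs_def] by (rule moment_fps_chi(3)[OF std_normal])
    show ?case
      unfolding eq using add conjunct2[OF Suc] d by (simp add: algebra_simps)
  qed
  then show "integrable M (\<lambda>\<omega>. chi_part a N \<omega> ^ n)"
    and "fps_deriv (moment_fps M (chi_part a N)) = moment_fps M (chi_part a N) * (\<Sum>k<N. cumulant_fps (a k))"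
    by auto
qed

context
  fixes a :: "nat \<Rightarrow> real"
  assumes sq: "summable (\<lambda>k. (a k)\<^sup>2)" and le1: "(\<Sum>k. (a k)\<^sup>2) \<le> 1"
begin

text \<open>
  A truncated sequence still has square sum at most 1, so the bound does not depend on \<open>N\<close>. This
  uniformity is what passes moments of all orders to the limit.
\<close>

lemma moment_chi_part_le: "\<bar>expectation (\<lambda>\<omega>. chi_part a N \<omega> ^ n)\<bar> \<le> 2 ^ n * fact n"
proof -
  let ?b = "\<lambda>k. if k < N then a k else 0"
  have b: "(?b k)\<^sup>2 \<le> (a k)\<^sup>2" for k by simp
  have sb: "summable (\<lambda>k. (?b k)\<^sup>2)"
    by (rule summable_comparison_test'[OF sq, of 0]) simp
  have "(\<Sum>k. (?b k)\<^sup>2) \<le> 1" using suminf_le[OF b sb sq] le1 by simp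
  note bound = chi_cumulants_bound[OF sb this]
  have "\<bar>fps_nth (moment_fps M (chi_part a N)) n\<bar> \<le> 2 ^ n"
    by (rule fps_exp_coeff_bound[OF moment_fps_chi_part(2)])
       (auto simp: chi_cumulants_truncate bound, simp add: moment_fps_def prob_space)
  then show ?thesis by (simp add: moment_fps_def field_simps)
qed

lemma AE_chi_part_tendsto: "AE \<omega> in M. (\<lambda>N. chi_part a N \<omega>) \<longlonglongrightarrow> chi_lim a \<omega>"
proof -
  have "AE \<omega> in M. summable (\<lambda>k. chi_term a k \<omega>)"
    by (rule AE_summable_indep[OF indep_chi_term])
       (simp_all add: integrable_chi_term_power expectation_chi_term second_moment_chi_term sq)
  then show ?thesis
    by eventually_elim (simp add: chi_part_def chi_lim_def summable_LIMSEQ)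
qed

text \<open>
  Even powers are nonnegative, hence Fatou's lemma applies to them.
\<close>

lemma moment_chi_lim_even:
  shows integrable_chi_lim_power_even: "integrable M (\<lambda>\<omega>. chi_lim a \<omega> ^ (2 * n))"
    and "expectation (\<lambda>\<omega>. chi_lim a \<omega> ^ (2 * n)) \<le> 2 ^ (2 * n) * fact (2 * n)"
proof -
  have lim: "AE \<omega> in M. (\<lambda>N. chi_part a N \<omega> ^ (2 * n)) \<longlonglongrightarrow> chi_lim a \<omega> ^ (2 * n)"
    using AE_chi_part_tendsto by eventually_elim (intro tendsto_intros)
  note * = Fatou_integral[OF _ _ _ lim]
  show "integrable M (\<lambda>\<omega>. chi_lim a \<omega> ^ (2 * n))"
    "expectation (\<lambda>\<omega>. chi_lim a \<omega> ^ (2 * n)) \<le> 2 ^ (2 * n) * fact (2 * n)"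
    using moment_chi_part_le[of _ "2 * n"] by (auto intro!: * moment_fps_chi_part(1) simp: abs_le_iff)
qed

lemma integrable_chi_lim_power: "integrable M (\<lambda>\<omega>. chi_lim a \<omega> ^ n)"
  by (rule integrable_power_of_even[OF finite_measure_axioms]) (auto intro: integrable_chi_lim_power_even)

text \<open>
  The partial sums converge in mean square, and their moments are uniformly bounded, so
  \<open>moment_diff_le\<close> gives convergence of each moment.
\<close>

lemma moment_chi_part_tendsto:
  "(\<lambda>N. expectation (\<lambda>\<omega>. chi_part a N \<omega> ^ n)) \<longlonglongrightarrow> expectation (\<lambda>\<omega>. chi_lim a \<omega> ^ n)"
proof (cases n)
  case (Suc m)
  \<comment> \<open>The summand \<open>1 / (N + 1)\<close> keeps \<open>w\<close> positive when only finitely many coefficients are nonzero.\<close>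
  define w where "w = (\<lambda>N. sqrt ((\<Sum>k. (a k)\<^sup>2) - (\<Sum>k<N. (a k)\<^sup>2) + inverse (real (Suc N))))"
  have tail: "(\<Sum>k<N. (a k)\<^sup>2) \<le> (\<Sum>k. (a k)\<^sup>2)" for N
    by (rule sum_le_suminf[OF sq]) auto
  have pos: "(\<Sum>k. (a k)\<^sup>2) - (\<Sum>k<N. (a k)\<^sup>2) + inverse (real (Suc N)) > 0" for N
    using tail[of N] by (intro add_nonneg_pos) auto
  have w: "w N > 0" "(w N)\<^sup>2 = (\<Sum>k. (a k)\<^sup>2) - (\<Sum>k<N. (a k)\<^sup>2) + inverse (real (Suc N))" for N
    using pos[of N] unfolding w_def by (simp_all only: real_sqrt_gt_0_iff real_sqrt_pow2 less_imp_le)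
  have "w \<longlonglongrightarrow> sqrt ((\<Sum>k. (a k)\<^sup>2) - (\<Sum>k. (a k)\<^sup>2) + 0)"
    unfolding w_def by (intro tendsto_intros summable_LIMSEQ sq LIMSEQ_inverse_real_of_nat)
  then have w0: "w \<longlonglongrightarrow> 0" by simp
  have L2: "expectation (\<lambda>\<omega>. (chi_part a N \<omega> - chi_lim a \<omega>)\<^sup>2) \<le> (w N)\<^sup>2" for N
  proof -
    have "expectation (\<lambda>\<omega>. (chi_lim a \<omega> - chi_part a N \<omega>)\<^sup>2) \<le> (\<Sum>k. (a k)\<^sup>2) - (\<Sum>k<N. (a k)\<^sup>2)"
      using second_moment_suminf_indep_tail(2)[OF indep_chi_term integrable_chi_term_power, of a N]
      by (simp add: expectation_chi_term second_moment_chi_term sq chi_part_def chi_lim_def)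
    also have "\<dots> \<le> (w N)\<^sup>2" unfolding w(2) by simp
    finally show ?thesis by (simp add: power2_commute)
  qed
  let ?B = "2 ^ (2 * m) * fact (2 * m) :: real"
  have bound: "\<bar>expectation (\<lambda>\<omega>. chi_part a N \<omega> ^ n) - expectation (\<lambda>\<omega>. chi_lim a \<omega> ^ n)\<bar>
      \<le> (1 / 2 + (real (Suc m))\<^sup>2 * ?B) * w N" for N
    unfolding Suc
    using moment_chi_part_le[of N "2 * m"] moment_chi_lim_even(2)[of m] w(1)
    by (intro moment_diff_le moment_fps_chi_part(1) integrable_chi_lim_power L2) auto
  have "(\<lambda>N. (1 / 2 + (real (Suc m))\<^sup>2 * ?B) * w N) \<longlonglongrightarrow> (1 / 2 + (real (Suc m))\<^sup>2 * ?B) * 0"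
    by (intro tendsto_intros w0)
  then have "(\<lambda>N. (1 / 2 + (real (Suc m))\<^sup>2 * ?B) * w N) \<longlonglongrightarrow> 0" by simp
  then have "(\<lambda>N. expectation (\<lambda>\<omega>. chi_part a N \<omega> ^ n) - expectation (\<lambda>\<omega>. chi_lim a \<omega> ^ n)) \<longlonglongrightarrow> 0"
    by (rule Lim_null_comparison[rotated]) (use bound in simp)
  then show ?thesis by (rule LIM_zero_cancel)
qed (simp add: prob_space)

lemma chi_cumulants_truncate_tendsto:
  "(\<lambda>N. fps_nth (\<Sum>k<N. cumulant_fps (a k)) i) \<longlonglongrightarrow> fps_nth (chi_cumulants a) i"
proof (cases i)
  case (Suc j)
  have "(\<lambda>N. sqrt 2 ^ i / sqrt 2 * (\<Sum>k<N. a k ^ (j + 2))) \<longlonglongrightarrow> sqrt 2 ^ i / sqrt 2 * (\<Sum>k. a k ^ (j + 2))"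
    by (intro tendsto_intros summable_LIMSEQ summable_power_coeff sq le1)
  then show ?thesis
    by (simp add: Suc chi_cumulants_def fps_sum_nth cumulant_fps_def sum_distrib_left)
qed (simp add: chi_cumulants_def fps_sum_nth cumulant_fps_def)

text \<open>
  Each coefficient of this equation involves finitely many moments and cumulants, so the equation
  for the partial sums passes to the limit coefficientwise.
\<close>

lemma moment_fps_chi_lim:
  "fps_deriv (moment_fps M (chi_lim a)) = moment_fps M (chi_lim a) * chi_cumulants a"
proof (rule fps_ext)
  fix i
  have lim: "(\<lambda>N. fps_nth (moment_fps M (chi_part a N)) n) \<longlonglongrightarrow> fps_nth (moment_fps M (chi_lim a)) n" for n
    unfolding moment_fps_def fps_nth_Abs_fps by (intro tendsto_intros moment_chi_part_tendsto) simp
  have "(\<lambda>N. fps_nth (fps_deriv (moment_fps M (chi_part a N))) i) \<longlonglongrightarrow> fps_nth (fps_deriv (moment_fps M (chi_lim a))) i"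
    unfolding fps_deriv_nth by (intro tendsto_intros lim)
  moreover have "(\<lambda>N. fps_nth (fps_deriv (moment_fps M (chi_part a N))) i)
      \<longlonglongrightarrow> fps_nth (moment_fps M (chi_lim a) * chi_cumulants a) i"
    unfolding moment_fps_chi_part(2) fps_mult_nth
    by (intro tendsto_intros lim chi_cumulants_truncate_tendsto)
  ultimately show "fps_nth (fps_deriv (moment_fps M (chi_lim a))) i = fps_nth (moment_fps M (chi_lim a) * chi_cumulants a) i"
    by (rule LIMSEQ_unique)
qed

lemma moment_fps_chi_lim_bound: "\<bar>fps_nth (moment_fps M (chi_lim a)) n\<bar> \<le> 2 ^ n"
  by (rule fps_exp_coeff_bound[OF moment_fps_chi_lim _ chi_cumulants_bound[OF sq le1]])
     (simp add: moment_fps_def prob_space)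

end
end

section \<open>The lower bound for the Wasserstein distance\<close>

lemma wasserstein2_geI:
  assumes "0 \<le> r"
    and "\<And>\<pi>. \<pi> \<in> couplings \<mu> \<nu> \<Longrightarrow> ennreal (r\<^sup>2) \<le> (\<integral>\<^sup>+p. ennreal (\<bar>fst p - snd p\<bar>\<^sup>2) \<partial>\<pi>)"
  shows "ennreal r \<le> wasserstein2 \<mu> \<nu>"
proof -
  define I where "I = (INF \<pi>\<in>couplings \<mu> \<nu>. \<integral>\<^sup>+p. ennreal (\<bar>fst p - snd p\<bar>\<^sup>2) \<partial>\<pi>)"
  have I: "ennreal (r\<^sup>2) \<le> I" unfolding I_def using assms(2) by (intro INF_greatest)
  have "ennreal r \<le> ennsqrt I"
  proof (cases I)
    case (real x)
    then have "r \<le> sqrt x" using I assms(1) by (intro real_le_rsqrt) simp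
    then show ?thesis using real by (simp add: ennsqrt_def ennreal_leI)
  qed (simp add: ennsqrt_def)
  then show ?thesis by (simp add: wasserstein2_def I_def)
qed

context std_normal_sequence
begin

text \<open>
  The sum of \<open>chi_series\<close> has its constant factor outside. Both versions agree where the series
  converges, which is almost everywhere.
\<close>

lemma distr_chi_series:
  assumes "summable (\<lambda>k. (a k)\<^sup>2)" "(\<Sum>k. (a k)\<^sup>2) \<le> 1"
  shows "distr M borel (chi_series Z a) = distr M borel (chi_lim a)"
proof (rule distr_cong_AE)
  have "AE \<omega> in M. summable (\<lambda>k. chi_term a k \<omega>)"
    by (rule AE_summable_indep[OF indep_chi_term])
       (simp_all add: integrable_chi_term_power expectation_chi_term second_moment_chi_term assms)
  then show "AE \<omega> in M. chi_series Z a \<omega> = chi_lim a \<omega>"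
  proof eventually_elim
    case (elim \<omega>)
    have "(\<lambda>k. a k * ((Z k \<omega>)\<^sup>2 - 1)) = (\<lambda>k. sqrt 2 * chi_term a k \<omega>)"
      by (simp add: chi_term_def)
    then show ?case using elim by (simp add: chi_series_def chi_lim_def suminf_mult)
  qed
qed (auto simp: chi_series_def)

lemma chi_sum_eq_chi_lim: "chi_sum Z q b = chi_lim (\<lambda>k. if k < q then b k else 0)"
proof
  fix \<omega>
  show "chi_sum Z q b \<omega> = chi_lim (\<lambda>k. if k < q then b k else 0) \<omega>"
    unfolding chi_lim_def chi_sum_def
    by (subst suminf_finite[of "{..<q}"]) (auto simp: chi_term_def sum_distrib_left)
qed

lemma tame_chi_lim:
  assumes "summable (\<lambda>k. (a k)\<^sup>2)" "(\<Sum>k. (a k)\<^sup>2) \<le> 1"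
  shows "tame_log_deriv (moment_fps M (chi_lim a)) (chi_cumulants a)"
  unfolding tame_log_deriv_def
  using moment_fps_chi_lim[OF assms] moment_fps_chi_lim_bound[OF assms] chi_cumulants_bound[OF assms]
  by (auto simp: moment_fps_def prob_space)

text \<open>
  A coupling carries the moments of both laws in its coordinates, so \<open>moment_diff_le\<close> applies on
  the product space. The constant uses the moment bound of order \<open>2 * n\<close> instead of \<open>2 * n - 2\<close>,
  which gives one formula for all \<open>n\<close>, including 0.
\<close>

lemma moment_coupling_diff:
  assumes a: "summable (\<lambda>k. (a k)\<^sup>2)" "(\<Sum>k. (a k)\<^sup>2) \<le> 1"
    and b: "summable (\<lambda>k. (b k)\<^sup>2)" "(\<Sum>k. (b k)\<^sup>2) \<le> 1"
    and \<pi>: "\<pi> \<in> couplings (distr M borel (chi_lim a)) (distr M borel (chi_lim b))"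
    and w: "w > 0" "(\<integral>\<^sup>+p. ennreal (\<bar>fst p - snd p\<bar>\<^sup>2) \<partial>\<pi>) \<le> ennreal (w\<^sup>2)"
  shows "\<bar>fps_nth (moment_fps M (chi_lim a)) n - fps_nth (moment_fps M (chi_lim b)) n\<bar>
    \<le> (1 / 2 + (real n)\<^sup>2 * (2 ^ (2 * n) * fact (2 * n))) * w"
proof (cases n)
  case (Suc m)
  have sets[measurable_cong]: "sets \<pi> = sets (borel \<Otimes>\<^sub>M borel)"
    and fst: "distr \<pi> borel fst = distr M borel (chi_lim a)"
    and snd: "distr \<pi> borel snd = distr M borel (chi_lim b)"
    using \<pi> by (auto simp: couplings_def)
  have [measurable]: "fst \<in> borel_measurable \<pi>" "snd \<in> borel_measurable \<pi>" by measurable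
  have fst_int: "integrable \<pi> (\<lambda>p. fst p ^ n)"
    and fst_E: "(\<integral>p. fst p ^ n \<partial>\<pi>) = expectation (\<lambda>\<omega>. chi_lim a \<omega> ^ n)" for n
    using arg_cong[OF fst, of "\<lambda>\<mu>. integrable \<mu> (\<lambda>x. x ^ n)"] arg_cong[OF fst, of "\<lambda>\<mu>. \<integral>x. x ^ n \<partial>\<mu>"]
      integrable_chi_lim_power[OF a, of n]
    by (simp_all add: integrable_distr_eq integral_distr)
  have snd_int: "integrable \<pi> (\<lambda>p. snd p ^ n)"
    and snd_E: "(\<integral>p. snd p ^ n \<partial>\<pi>) = expectation (\<lambda>\<omega>. chi_lim b \<omega> ^ n)" for n
    using arg_cong[OF snd, of "\<lambda>\<mu>. integrable \<mu> (\<lambda>x. x ^ n)"] arg_cong[OF snd, of "\<lambda>\<mu>. \<integral>x. x ^ n \<partial>\<mu>"]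
      integrable_chi_lim_power[OF b, of n]
    by (simp_all add: integrable_distr_eq integral_distr)
  let ?B = "2 ^ (2 * m) * fact (2 * m) :: real"
  have "(\<integral>p. (fst p - snd p)\<^sup>2 \<partial>\<pi>) = enn2real (\<integral>\<^sup>+p. ennreal ((fst p - snd p)\<^sup>2) \<partial>\<pi>)"
    by (rule integral_eq_nn_integral) auto
  also have "\<dots> \<le> w\<^sup>2" using w by (intro enn2real_leI) auto
  finally have "\<bar>(\<integral>p. fst p ^ Suc m \<partial>\<pi>) - (\<integral>p. snd p ^ Suc m \<partial>\<pi>)\<bar> \<le> (1 / 2 + (real (Suc m))\<^sup>2 * ?B) * w"
    using moment_chi_lim_even(2)[OF a, of m] moment_chi_lim_even(2)[OF b, of m] w(1)
    by (intro moment_diff_le fst_int snd_int) (auto simp: fst_E snd_E)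
  also have "\<dots> \<le> (1 / 2 + (real n)\<^sup>2 * (2 ^ (2 * n) * fact (2 * n))) * w"
    unfolding Suc using w(1)
    by (intro mult_right_mono add_mono mult_left_mono mult_mono fact_mono power_increasing) auto
  finally have le: "\<bar>expectation (\<lambda>\<omega>. chi_lim a \<omega> ^ n) - expectation (\<lambda>\<omega>. chi_lim b \<omega> ^ n)\<bar>
      \<le> (1 / 2 + (real n)\<^sup>2 * (2 ^ (2 * n) * fact (2 * n))) * w"
    by (simp only: fst_E snd_E Suc)
  have "\<bar>x / fact n - y / fact n\<bar> \<le> \<bar>x - y\<bar>" for x y :: real
    by (simp add: diff_divide_distrib[symmetric] divide_le_eq mult_le_cancel_left1 fact_ge_1)
  from order_trans[OF this le] show ?thesis by (simp add: moment_fps_def)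
qed (use w in \<open>simp add: moment_fps_def\<close>)

text \<open>
  The constant is uniform over all sequences \<open>a\<close> with square sum at most 1. A coupling whose mean
  square cost were below \<open>w\<^sup>2\<close> would give \<open>Delta q b a \<le> D * w\<close>, and for
  \<open>w = Delta q b a / (2 * D)\<close> this is absurd if \<open>Delta q b a > 0\<close>. So every coupling costs
  at least \<open>w\<^sup>2\<close>, and so does the infimum.
\<close>

theorem Delta_le_wasserstein2:
  assumes b: "(\<Sum>k<q. (b k)\<^sup>2) \<le> 1"
  shows "\<exists>C>0. \<forall>a. summable (\<lambda>k. (a k)\<^sup>2) \<longrightarrow> (\<Sum>k. (a k)\<^sup>2) \<le> 1 \<longrightarrow>
    ennreal (C * Delta q b a) \<le> wasserstein2 (distr M borel (chi_series Z a)) (distr M borel (chi_sum Z q b))"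
proof -
  define b' where "b' = (\<lambda>k. if k < q then b k else 0)"
  have "(\<lambda>k. (b' k)\<^sup>2) sums (\<Sum>k<q. (b' k)\<^sup>2)"
    by (rule sums_finite) (auto simp: b'_def)
  then have b': "summable (\<lambda>k. (b' k)\<^sup>2)" "(\<Sum>k. (b' k)\<^sup>2) \<le> 1"
    using b by (auto simp: sums_iff b'_def)
  define c where "c = (\<lambda>n::nat. 1 / 2 + (real n)\<^sup>2 * (2 ^ (2 * n) * fact (2 * n)) :: real)"
  obtain d where d: "\<And>n F K G L w. tame_log_deriv F K \<Longrightarrow> tame_log_deriv G L \<Longrightarrow>
      (\<And>i. \<bar>fps_nth F i - fps_nth G i\<bar> \<le> c i * w) \<Longrightarrow> \<bar>fps_nth K n - fps_nth L n\<bar> \<le> d n * w"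
    using log_deriv_lipschitz[of c] by metis
  let ?Q = "Delta_poly q b"
  \<comment> \<open>The summand 1 only ensures that \<open>D\<close> is positive.\<close>
  define D where "D = 1 + \<bar>\<Sum>j\<le>degree ?Q. \<bar>coeff ?Q j / sqrt 2 ^ j\<bar> * d (Suc j)\<bar>"
  have D: "D > 0" unfolding D_def by (simp add: add_pos_nonneg)
  have "ennreal (1 / (2 * D) * Delta q b a)
      \<le> wasserstein2 (distr M borel (chi_series Z a)) (distr M borel (chi_sum Z q b))"
    if a: "summable (\<lambda>k. (a k)\<^sup>2)" "(\<Sum>k. (a k)\<^sup>2) \<le> 1" for a
  proof (cases "Delta q b a > 0")
    case True
    define w where "w = 1 / (2 * D) * Delta q b a"
    have w: "w > 0" using D True by (simp add: w_def)
    show ?thesis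
      unfolding distr_chi_series[OF a] chi_sum_eq_chi_lim b'_def[symmetric] w_def[symmetric]
    proof (rule wasserstein2_geI, use w in simp, rule ccontr)
      fix \<pi> assume \<pi>: "\<pi> \<in> couplings (distr M borel (chi_lim a)) (distr M borel (chi_lim b'))"
      assume "\<not> ennreal (w\<^sup>2) \<le> (\<integral>\<^sup>+p. ennreal (\<bar>fst p - snd p\<bar>\<^sup>2) \<partial>\<pi>)"
      then have le: "(\<integral>\<^sup>+p. ennreal (\<bar>fst p - snd p\<bar>\<^sup>2) \<partial>\<pi>) \<le> ennreal (w\<^sup>2)"
        by simp
      have K: "\<bar>fps_nth (chi_cumulants a) n - fps_nth (chi_cumulants b') n\<bar> \<le> d n * w" for n
        unfolding c_def
        by (rule d[OF tame_chi_lim[OF a] tame_chi_lim[OF b']])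
           (unfold c_def, rule moment_coupling_diff[OF a b' \<pi> w le])
      have "Delta q b a = Delta q b a - Delta q b b'"
        unfolding b'_def Delta_target by simp
      also have "\<dots> = (\<Sum>j\<le>degree ?Q. coeff ?Q j / sqrt 2 ^ j *
          (fps_nth (chi_cumulants a) (Suc j) - fps_nth (chi_cumulants b') (Suc j)))"
        unfolding Delta_eq_cumulants[OF a] Delta_eq_cumulants[OF b']
        by (simp only: sum_subtractf right_diff_distrib)
      also have "\<dots> \<le> (\<Sum>j\<le>degree ?Q. \<bar>coeff ?Q j / sqrt 2 ^ j\<bar> * (d (Suc j) * w))"
      proof (rule sum_mono)
        fix j
        let ?x = "fps_nth (chi_cumulants a) (Suc j) - fps_nth (chi_cumulants b') (Suc j)"
        have "coeff ?Q j / sqrt 2 ^ j * ?x \<le> \<bar>coeff ?Q j / sqrt 2 ^ j\<bar> * \<bar>?x\<bar>"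
          by (metis abs_ge_self abs_mult)
        also have "\<dots> \<le> \<bar>coeff ?Q j / sqrt 2 ^ j\<bar> * (d (Suc j) * w)"
          by (rule mult_left_mono[OF K]) simp
        finally show "coeff ?Q j / sqrt 2 ^ j * ?x \<le> \<bar>coeff ?Q j / sqrt 2 ^ j\<bar> * (d (Suc j) * w)" .
      qed
      also have "\<dots> = (\<Sum>j\<le>degree ?Q. \<bar>coeff ?Q j / sqrt 2 ^ j\<bar> * d (Suc j)) * w"
        by (simp only: sum_distrib_right mult.assoc)
      also have "\<dots> \<le> D * w" using w by (intro mult_right_mono) (auto simp: D_def)
      also have "\<dots> = Delta q b a / 2" using D by (simp add: w_def)
      finally show False using True by simp
    qed
  next
    case False
    then have "1 / (2 * D) * Delta q b a \<le> 0" using D by (simp add: divide_le_0_iff)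
    then show ?thesis by (simp only: ennreal_neg zero_le)
  qed
  then show ?thesis using D by (intro exI[of _ "1 / (2 * D)"]) simp
qed

end

theorem proposition2p4:
  fixes M :: "'a measure"
    and Z :: "nat \<Rightarrow> 'a \<Rightarrow> real"
    and q :: nat
    and \<alpha>_inf :: "nat \<Rightarrow> real"
    and \<alpha> :: "nat \<Rightarrow> nat \<Rightarrow> real"
    and \<rho> :: real
  assumes "prob_space M"
    and "prob_space.indep_vars M (\<lambda>_. borel) Z UNIV"
    and "\<And>k. distributed M lborel (Z k) std_normal_density"
    and "\<And>k. k < q \<Longrightarrow> \<alpha>_inf k \<noteq> 0"
    and "(\<Sum>k<q. (\<alpha>_inf k)\<^sup>2) = 1"
    and "\<And>n. (\<lambda>k. (\<alpha> n k)\<^sup>2) sums 1"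
    and "0 < \<rho>" and "\<rho> < 1 / (4 * exp 1)"
  shows "\<exists>C::real. C > 0 \<and>
           (\<forall>n. wasserstein2 (distr M borel (chi_series Z (\<alpha> n)))
                             (distr M borel (chi_sum Z q \<alpha>_inf))
                \<ge> ennreal (C * Delta q \<alpha>_inf (\<alpha> n)))"
proof -
  interpret std_normal_sequence M Z
    using assms(1-3) by (simp add: std_normal_sequence_def std_normal_sequence_axioms_def)
  have "summable (\<lambda>k. (\<alpha> n k)\<^sup>2)" "(\<Sum>k. (\<alpha> n k)\<^sup>2) \<le> 1" for n
    using assms(6)[of n] by (auto simp: sums_iff)
  with Delta_le_wasserstein2[of \<alpha>_inf q] assms(5) show ?thesis by fastforce
qed

end
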